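(* Let $n\ge 2$. Let $X=\{e_{ij}=e_{ji}: 1\le i<j\le n\}\cup\{t_{ij},t_{ji}: 1\le i<j\le n\}$ be an alphabet (so $e_{ij}$ and $e_{ji}$ denote the same letter, while $t_{ij}$ and $t_{ji}$ are different letters), and let $\phi:X^+\to \mathrm{Sing}(\mathcal P_n^{\mathrm{fd}})$ be the semigroup morphism determined by $e_{ij}\mapsto\overline e_{ij}$, $t_{ij}\mapsto\overline t_{ij}$. Let $R$ be the following set of relations over $X$, where $i,j,k,l\in\{1,\dots,n\}$ are distinct in all relations, except for the relation $e_{ij}e_{kl}=e_{kl}e_{ij}$, which only requires $i\ne j$ and $k\ne l$: $$t_{ij}^2=t_{ij}=t_{ji}t_{ij},\qquad t_{ij}t_{kl}=t_{kl}t_{ij},\qquad t_{ik}t_{jk}=t_{ik},\qquad t_{ij}t_{ik}=t_{ik}t_{ij}=t_{jk}t_{ij},$$ $$t_{ki}t_{ij}t_{jk}=t_{ik}t_{kj}t_{ji}t_{ik},\qquad t_{ki}t_{ij}t_{jk}t_{kl}=t_{ik}t_{kl}t_{li}t_{ij}t_{jl},$$ $$e_{ij}^2=e_{ij},\qquad e_{ij}e_{kl}=e_{kl}e_{ij},\qquad e_{ij}e_{jk}=e_{jk}e_{ki},$$ $$e_{ij}t_{ij}=t_{ij},\qquad e_{jk}t_{ij}=t_{ij}e_{ik},\qquad e_{kl}t_{ij}=t_{ij}e_{kl},\qquad t_{ij}e_{ij}=e_{ij}.$$ Then the semigroup $\mathrm{Sing}(\mathcal P_n^{\mathrm{fd}})=\mathcal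 P_n^{\mathrm{fd}}\setminus\mathcal S_n$ has semigroup presentation $\langle X: R\rangle$ via $\phi$. Consequently, $\mathrm{Sing}(\mathcal P_n^{\mathrm{fd}})$ is idempotent-generated.
   Context: Partition monoid: let $\mathbf n=\{1,\dots,n\}$, and let $\mathbf n'=\{1',\dots,n'\}$ and $\mathbf n''=\{1'',\dots,n''\}$ be disjoint copies of $\mathbf n$. The partition monoid $\mathcal P_n$ is the set of all set partitions of $\mathbf n\cup\mathbf n'$, with product defined as follows. For $a,b\in\mathcal P_n$, let $a^\downarrow$ be the partition of $\mathbf n\cup\mathbf n''$ obtained from $a$ by renaming each $x'$ as $x''$, and $b^\uparrow$ the partition of $\mathbf n''\cup\mathbf n'$ obtained from $b$ by renaming each $x\in\mathbf n$ as $x''$. Then $x,y\in\mathbf n\cup\mathbf n'$ belong to the same block of $ab$ iff they are related by the smallest equivalence relation on $\mathbf n\cup\mathbf n''\cup\mathbf n'$ that relates any two elements lying in a common block of $a^\downarrow$ or of $b^\uparrow$. The identity is the partition $1$ with blocks $\{x,x'\}$, $x\in\mathbf n$. The full-domain partition monoid $\mathcal P_n^{\mathrm{fd}}$ is the submonoid of all $a\in\mathcal P_n$ such that every element of $\mathbf n$ lies in a block containing at least one element of $\mathbf n'$. The symmetric group $\mathcal S_n$ is identified with the set of partitions of the form $\{\{x,(xf)'\}:x\in\mathbf n\}$, $f$ a permutation of $\mathbf n$; it is the group of units of $\mathcal P_n^{\mathrm{fd}}$. $\mathrm{Sing}(\mathcal P_n^{\mathrm{fd}})=\mathcal P_n^{\mathrm{fd}}\setminus\mathcal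 S_n$. For distinct $i,j\in\mathbf n$: $\overline e_{ij}$ is the partition with blocks $\{i,j,i',j'\}$ and $\{x,x'\}$ for $x\in\mathbf n\setminus\{i,j\}$; $\overline t_{ij}$ is the partition with blocks $\{i,j,i'\}$, $\{j'\}$ and $\{x,x'\}$ for $x\in\mathbf n\setminus\{i,j\}$. Presentations: $X^+$ is the free semigroup of non-empty words over $X$. A relation $u=v$ stands for the pair $(u,v)$. A semigroup $S$ has semigroup presentation $\langle X:R\rangle$ via $\phi:X^+\to S$ if $\phi$ is a surjective morphism whose kernel $\{(u,v):u\phi=v\phi\}$ is the congruence on $X^+$ generated by $R$. *)

theory Defs
  imports "HOL-Library.Disjoint_Sets" "HOL-Combinatorics.Permutations"
begin

subsection \<open>Partition monoids\<close>

(* Upper x, Lower x and Middle x stand for x, x' and x''. *)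
datatype point = Upper nat | Lower nat | Middle nat

definition points :: "nat \<Rightarrow> point set" where
  "points n = Upper ` {1..n} \<union> Lower ` {1..n}"

definition points3 :: "nat \<Rightarrow> point set" where
  "points3 n = Upper ` {1..n} \<union> Middle ` {1..n} \<union> Lower ` {1..n}"

definition partition_monoid :: "nat \<Rightarrow> point set set set" where
  "partition_monoid n = {a. partition_on (points n) a}"

fun lower_to_middle :: "point \<Rightarrow> point" where
  "lower_to_middle (Upper x) = Upper x"
| "lower_to_middle (Lower x) = Middle x"
| "lower_to_middle (Middle x) = Middle x"

fun upper_to_middle :: "point \<Rightarrow> point" where
  "upper_to_middle (Upper x) = Middle x"
| "upper_to_middle (Lower x) = Lower x"
| "upper_to_middle (Middle x) = Middle x"

definition down :: "point set set \<Rightarrow> point set set" where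
  "down a = (`) lower_to_middle ` a"

definition up :: "point set set \<Rightarrow> point set set" where
  "up b = (`) upper_to_middle ` b"

definition same_block :: "point set set \<Rightarrow> (point \<times> point) set" where
  "same_block a = {(x, y). \<exists>B\<in>a. x \<in> B \<and> y \<in> B}"

definition product_equiv ::
  "nat \<Rightarrow> point set set \<Rightarrow> point set set \<Rightarrow> (point \<times> point) set" where
  "product_equiv n a b =
     \<Inter> {r. equiv (points3 n) r \<and> same_block (down a) \<union> same_block (up b) \<subseteq> r}"

definition pmult :: "nat \<Rightarrow> point set set \<Rightarrow> point set set \<Rightarrow> point set set" where
  "pmult n a b = points n // (product_equiv n a b \<inter> points n \<times> points n)"

definition full_domain :: "nat \<Rightarrow> point set set set" where
  "full_domain n =
     {a \<in> partition_monoid n. \<forall>x\<in>{1..n}. \<exists>B\<in>a. Upper x \<in> B \<and> (\<exists>y\<in>{1..n}. Lower y \<in> B)}"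

definition sym_partitions :: "nat \<Rightarrow> point set set set" where
  "sym_partitions n = {{{Upper x, Lower (f x)} |x. x \<in> {1..n}} |f. f permutes {1..n}}"

definition sing_full_domain :: "nat \<Rightarrow> point set set set" where
  "sing_full_domain n = full_domain n - sym_partitions n"

definition ebar :: "nat \<Rightarrow> nat \<Rightarrow> nat \<Rightarrow> point set set" where
  "ebar n i j =
     {{Upper i, Upper j, Lower i, Lower j}} \<union> {{Upper x, Lower x} |x. x \<in> {1..n} - {i, j}}"

definition tbar :: "nat \<Rightarrow> nat \<Rightarrow> nat \<Rightarrow> point set set" where
  "tbar n i j =
     {{Upper i, Upper j, Lower i}, {Lower j}} \<union> {{Upper x, Lower x} |x. x \<in> {1..n} - {i, j}}"

subsection \<open>Semigroup presentations\<close>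

(* A semigroup is given by a carrier set S and a multiplication m. *)
definition semigroup_on :: "'s set \<Rightarrow> ('s \<Rightarrow> 's \<Rightarrow> 's) \<Rightarrow> bool" where
  "semigroup_on S m \<longleftrightarrow>
     (\<forall>a\<in>S. \<forall>b\<in>S. m a b \<in> S) \<and>
     (\<forall>a\<in>S. \<forall>b\<in>S. \<forall>c\<in>S. m (m a b) c = m a (m b c))"

definition free_semigroup :: "'x set \<Rightarrow> 'x list set" where
  "free_semigroup X = lists X - {[]}"

definition congruence_on :: "'s set \<Rightarrow> ('s \<Rightarrow> 's \<Rightarrow> 's) \<Rightarrow> ('s \<times> 's) set \<Rightarrow> bool" where
  "congruence_on S m C \<longleftrightarrow>
     equiv S C \<and> (\<forall>(a, b)\<in>C. \<forall>c\<in>S. (m a c, m b c) \<in> C \<and> (m c a, m c b) \<in> C)"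

definition generated_congruence ::
  "'s set \<Rightarrow> ('s \<Rightarrow> 's \<Rightarrow> 's) \<Rightarrow> ('s \<times> 's) set \<Rightarrow> ('s \<times> 's) set" where
  "generated_congruence S m R = \<Inter> {C. congruence_on S m C \<and> R \<subseteq> C}"

definition has_semigroup_presentation ::
  "'s set \<Rightarrow> ('s \<Rightarrow> 's \<Rightarrow> 's) \<Rightarrow> 'x set \<Rightarrow> ('x list \<times> 'x list) set \<Rightarrow> ('x list \<Rightarrow> 's) \<Rightarrow> bool"
where
  "has_semigroup_presentation S m X R \<phi> \<longleftrightarrow>
     semigroup_on S m \<and>
     R \<subseteq> free_semigroup X \<times> free_semigroup X \<and>
     (\<forall>u\<in>free_semigroup X. \<forall>v\<in>free_semigroup X. \<phi> (u @ v) = m (\<phi> u) (\<phi> v)) \<and>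
     \<phi> ` free_semigroup X = S \<and>
     {(u, v). u \<in> free_semigroup X \<and> v \<in> free_semigroup X \<and> \<phi> u = \<phi> v}
       = generated_congruence (free_semigroup X) (@) R"

(* The morphism from non-empty words determined by the images g of the letters;
   its value on the empty word is irrelevant. *)
definition word_morphism :: "('s \<Rightarrow> 's \<Rightarrow> 's) \<Rightarrow> ('x \<Rightarrow> 's) \<Rightarrow> 'x list \<Rightarrow> 's" where
  "word_morphism m g w = foldl m (g (hd w)) (map g (tl w))"

inductive_set generated_subsemigroup :: "('s \<Rightarrow> 's \<Rightarrow> 's) \<Rightarrow> 's set \<Rightarrow> 's set"
  for m :: "'s \<Rightarrow> 's \<Rightarrow> 's" and A :: "'s set" where
  "a \<in> A \<Longrightarrow> a \<in> generated_subsemigroup m A"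
| "\<lbrakk>a \<in> generated_subsemigroup m A; b \<in> generated_subsemigroup m A\<rbrakk>
     \<Longrightarrow> m a b \<in> generated_subsemigroup m A"

definition idempotent_generated :: "'s set \<Rightarrow> ('s \<Rightarrow> 's \<Rightarrow> 's) \<Rightarrow> bool" where
  "idempotent_generated S m \<longleftrightarrow> generated_subsemigroup m {a \<in> S. m a a = a} = S"

subsection \<open>The alphabet, the morphism and the relations\<close>

(* The letters e_ij are indexed by two-element sets, so that e_ij and e_ji are the same letter. *)
datatype letter = EdgeLetter "nat set" | T nat nat

abbreviation E :: "nat \<Rightarrow> nat \<Rightarrow> letter" where
  "E i j \<equiv> EdgeLetter {i, j}"

definition alphabet :: "nat \<Rightarrow> letter set" where
  "alphabet n =
     {E i j |i j. 1 \<le> i \<and> i < j \<and> j \<le> n} \<union>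
     {T i j |i j. 1 \<le> i \<and> i < j \<and> j \<le> n} \<union> {T j i |i j. 1 \<le> i \<and> i < j \<and> j \<le> n}"

(* Min and Max recover the indices of a letter e_ij up to order; see letter_image_E. *)
fun letter_image :: "nat \<Rightarrow> letter \<Rightarrow> point set set" where
  "letter_image n (EdgeLetter A) = ebar n (Min A) (Max A)"
| "letter_image n (T i j) = tbar n i j"

lemma letter_image_E: "letter_image n (E i j) = ebar n i j"
proof (cases "i \<le> j")
  case True
  then show ?thesis by (simp add: max_def min_def)
next
  case False
  then have "letter_image n (E i j) = ebar n j i" by (simp add: max_def min_def)
  also have "\<dots> = ebar n i j" by (simp add: ebar_def insert_commute)
  finally show ?thesis .
qed

definition \<phi> :: "nat \<Rightarrow> letter list \<Rightarrow> point set set" where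
  "\<phi> n = word_morphism (pmult n) (letter_image n)"

inductive_set relations :: "nat \<Rightarrow> (letter list \<times> letter list) set" for n :: nat where
  tt1: "\<lbrakk>{i, j} \<subseteq> {1..n}; distinct [i, j]\<rbrakk> \<Longrightarrow>
    ([T i j, T i j], [T i j]) \<in> relations n"
| tt2: "\<lbrakk>{i, j} \<subseteq> {1..n}; distinct [i, j]\<rbrakk> \<Longrightarrow>
    ([T i j], [T j i, T i j]) \<in> relations n"
| tt_comm: "\<lbrakk>{i, j, k, l} \<subseteq> {1..n}; distinct [i, j, k, l]\<rbrakk> \<Longrightarrow>
    ([T i j, T k l], [T k l, T i j]) \<in> relations n"
| tt3: "\<lbrakk>{i, j, k} \<subseteq> {1..n}; distinct [i, j, k]\<rbrakk> \<Longrightarrow>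
    ([T i k, T j k], [T i k]) \<in> relations n"
| tt4: "\<lbrakk>{i, j, k} \<subseteq> {1..n}; distinct [i, j, k]\<rbrakk> \<Longrightarrow>
    ([T i j, T i k], [T i k, T i j]) \<in> relations n"
| tt5: "\<lbrakk>{i, j, k} \<subseteq> {1..n}; distinct [i, j, k]\<rbrakk> \<Longrightarrow>
    ([T i k, T i j], [T j k, T i j]) \<in> relations n"
| ttt: "\<lbrakk>{i, j, k} \<subseteq> {1..n}; distinct [i, j, k]\<rbrakk> \<Longrightarrow>
    ([T k i, T i j, T j k], [T i k, T k j, T j i, T i k]) \<in> relations n"
| tttt: "\<lbrakk>{i, j, k, l} \<subseteq> {1..n}; distinct [i, j, k, l]\<rbrakk> \<Longrightarrow>
    ([T k i, T i j, T j k, T k l], [T i k, T k l, T l i, T i j, T j l]) \<in> relations n"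
| ee1: "\<lbrakk>{i, j} \<subseteq> {1..n}; distinct [i, j]\<rbrakk> \<Longrightarrow>
    ([E i j, E i j], [E i j]) \<in> relations n"
| ee_comm: "\<lbrakk>{i, j, k, l} \<subseteq> {1..n}; i \<noteq> j; k \<noteq> l\<rbrakk> \<Longrightarrow>
    ([E i j, E k l], [E k l, E i j]) \<in> relations n"
| ee2: "\<lbrakk>{i, j, k} \<subseteq> {1..n}; distinct [i, j, k]\<rbrakk> \<Longrightarrow>
    ([E i j, E j k], [E j k, E k i]) \<in> relations n"
| et1: "\<lbrakk>{i, j} \<subseteq> {1..n}; distinct [i, j]\<rbrakk> \<Longrightarrow>
    ([E i j, T i j], [T i j]) \<in> relations n"
| et2: "\<lbrakk>{i, j, k} \<subseteq> {1..n}; distinct [i, j, k]\<rbrakk> \<Longrightarrow>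
    ([E j k, T i j], [T i j, E i k]) \<in> relations n"
| et3: "\<lbrakk>{i, j, k, l} \<subseteq> {1..n}; distinct [i, j, k, l]\<rbrakk> \<Longrightarrow>
    ([E k l, T i j], [T i j, E k l]) \<in> relations n"
| et4: "\<lbrakk>{i, j} \<subseteq> {1..n}; distinct [i, j]\<rbrakk> \<Longrightarrow>
    ([T i j, E i j], [E i j]) \<in> relations n"

end

theory Submission
  imports Defs
begin

text \<open>
  A full-domain partition is a pair consisting of an equivalence \<open>e\<close> on \<open>{1..n}\<close> (its trace on the
  lower row) and a map \<open>f\<close> from \<open>{1..n}\<close> to the classes of \<open>e\<close>. The letter \<open>t\<^sub>i\<^sub>j\<close> is the map
  sending \<open>j\<close> to \<open>i\<close>, and \<open>e\<^sub>i\<^sub>j\<close> joins two classes. The relations move all letters \<open>e\<^sub>i\<^sub>j\<close> to the right,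
  where they form a semilattice determined by \<open>e\<close>; since \<open>t\<^sub>i\<^sub>j e\<^sub>i\<^sub>j = e\<^sub>i\<^sub>j\<close>, the map may then be composed
  with a choice of class representatives. It remains to see that words in the letters \<open>t\<^sub>i\<^sub>j\<close> with
  the same map \<open>f\<close> are equivalent.

  Because \<open>e\<^sub>k\<^sub>l u = u\<close> whenever \<open>f\<close> identifies \<open>k\<close> and \<open>l\<close>, also \<open>t\<^sub>k\<^sub>l u = u\<close>, so both words may be
  preceded by the same word \<open>p\<close> whose map is idempotent with the kernel of \<open>f\<close>. After \<open>p\<close>, the points of the image
  are tokens which the letters slide into empty positions. Relative to an empty position \<open>k\<close>, the word
  \<open>t\<^sub>k\<^sub>i t\<^sub>i\<^sub>j t\<^sub>j\<^sub>k\<close> swaps the positions \<open>i\<close> and \<open>j\<close>. The two long relations say that this swap is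
  symmetric in \<open>i, j\<close> and commutes with moving \<open>k\<close>; hence the swaps satisfy the conjugation relations of
  transpositions, every token can be removed from a product of swaps fixing it, and
  swaps of empty positions are trivial.
\<close>

declare atLeastAtMost_iff [simp del] One_nat_def [simp del]

fun act :: "letter \<Rightarrow> nat \<Rightarrow> nat" where
  "act (T i j) x = (if x = j then i else x)"
| "act (EdgeLetter A) x = x"

text \<open>\<open>fold\<close> lets the leftmost letter act first, so concatenating words composes
  maps in the order of \<open>pmult\<close>.\<close>

abbreviation word_map :: "letter list \<Rightarrow> nat \<Rightarrow> nat" where
  "word_map w \<equiv> fold act w"


subsection \<open>Full-domain partitions as maps modulo an equivalence\<close>

text \<open>Every block of a full-domain partition meets the lower row. The anchor is a lower point
  in the block of the given point, unique only up to the equivalence \<open>e\<close> of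
  \<open>fd_rel\<close>.\<close>

fun anchor :: "(nat \<Rightarrow> nat) \<Rightarrow> point \<Rightarrow> nat" where
  "anchor f (Upper x) = f x"
| "anchor f (Lower x) = x"
| "anchor f (Middle x) = x"

inductive_set equiv_cl :: "nat \<Rightarrow> (nat \<times> nat) set \<Rightarrow> (nat \<times> nat) set" for n A where
  equiv_cl_base: "(x, y) \<in> A \<Longrightarrow> (x, y) \<in> equiv_cl n A"
| equiv_cl_refl: "x \<in> {1..n} \<Longrightarrow> (x, x) \<in> equiv_cl n A"
| equiv_cl_sym: "(x, y) \<in> equiv_cl n A \<Longrightarrow> (y, x) \<in> equiv_cl n A"
| equiv_cl_trans: "(x, y) \<in> equiv_cl n A \<Longrightarrow> (y, z) \<in> equiv_cl n A \<Longrightarrow> (x, z) \<in> equiv_cl n A"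

definition fd_rel :: "nat \<Rightarrow> (nat \<Rightarrow> nat) \<Rightarrow> (nat \<times> nat) set \<Rightarrow> (point \<times> point) set" where
  "fd_rel n f e = {(p, q) \<in> points n \<times> points n. (anchor f p, anchor f q) \<in> e}"

definition fd_partition :: "nat \<Rightarrow> (nat \<Rightarrow> nat) \<Rightarrow> (nat \<times> nat) set \<Rightarrow> point set set" where
  "fd_partition n f e = points n // fd_rel n f e"

text \<open>
  The square \<open>A \<times> A\<close> avoids choosing an order on the indices of \<open>E i j\<close>; only the equivalence
  generated by these pairs matters.
\<close>

fun letter_pairs :: "letter \<Rightarrow> (nat \<times> nat) set" where
  "letter_pairs (T i j) = {}"
| "letter_pairs (EdgeLetter A) = A \<times> A"

text \<open>The letters after \<open>a\<close> carry the points that \<open>a\<close> joins to other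
  positions, so its pairs are transported by the map of the remaining word.\<close>

fun word_pairs :: "letter list \<Rightarrow> (nat \<times> nat) set" where
  "word_pairs [] = {}"
| "word_pairs (a # w) = map_prod (word_map w) (word_map w) ` letter_pairs a \<union> word_pairs w"

lemma word_pairs_append [simp]: "word_pairs (u @ v) = map_prod (word_map v) (word_map v) ` word_pairs u \<union> word_pairs v"
  by (induction u) (auto simp: image_Un image_image map_prod_def split_beta)

section \<open>Equivalences generated by sets of pairs\<close>

lemma equiv_equiv_cl:
  assumes "A \<subseteq> {1..n} \<times> {1..n}"
  shows "equiv {1..n} (equiv_cl n A)"
proof (rule equivI)
  show "equiv_cl n A \<subseteq> {1..n} \<times> {1..n}"
  proof (rule subrelI)
    fix x y assume "(x, y) \<in> equiv_cl n A"
    then show "(x, y) \<in> {1..n} \<times> {1..n}" by induction (use assms in auto)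
  qed
qed (auto intro!: refl_onI symI transI intro: equiv_cl.intros)

lemma equiv_cl_least:
  assumes "equiv {1..n} e" "A \<subseteq> e"
  shows "equiv_cl n A \<subseteq> e"
proof (rule subrelI)
  fix x y assume "(x, y) \<in> equiv_cl n A"
  then show "(x, y) \<in> e"
    by induction (use assms in \<open>auto dest: equivE elim: equivE intro: symD transD refl_onD\<close>)
qed

lemma equiv_cl_mono: "A \<subseteq> equiv_cl n B \<Longrightarrow> equiv_cl n A \<subseteq> equiv_cl n B"
proof (rule subrelI)
  fix x y assume "A \<subseteq> equiv_cl n B" "(x, y) \<in> equiv_cl n A"
  from this(2) this(1) show "(x, y) \<in> equiv_cl n B"
    by induction (auto intro: equiv_cl.intros)
qed

lemma equiv_cl_eqI: "A \<subseteq> equiv_cl n B \<Longrightarrow> B \<subseteq> equiv_cl n A \<Longrightarrow> equiv_cl n A = equiv_cl n B"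
  using equiv_cl_mono by (metis subset_antisym)

lemma equiv_cl_map:
  assumes "(x, y) \<in> equiv_cl n A" "\<And>x. x \<in> {1..n} \<Longrightarrow> g x \<in> {1..n}"
  shows "(g x, g y) \<in> equiv_cl n (map_prod g g ` A)"
  using assms by induction (auto intro: equiv_cl.intros)

lemma equiv_cl_Id: "A \<subseteq> Id \<Longrightarrow> A \<subseteq> {1..n} \<times> {1..n} \<Longrightarrow> equiv_cl n A = Id_on {1..n}"
  by (rule antisym[OF equiv_cl_least]) (auto intro: equiv_cl.intros equivI refl_onI symI transI)

section \<open>Full-domain partitions and their products\<close>

lemma anchor_in:
  "p \<in> points n \<Longrightarrow> (\<And>x. x \<in> {1..n} \<Longrightarrow> f x \<in> {1..n}) \<Longrightarrow> anchor f p \<in> {1..n}"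
  by (auto simp: points_def)

lemma equiv_part_rel:
  assumes "equiv {1..n} e" "\<And>x. x \<in> {1..n} \<Longrightarrow> f x \<in> {1..n}"
  shows "equiv (points n) (fd_rel n f e)"
proof (rule equivI)
  show "refl_on (points n) (fd_rel n f e)"
    using assms anchor_in[of _ n f] by (auto simp: fd_rel_def refl_on_def equiv_def)
  show "sym (fd_rel n f e)" "trans (fd_rel n f e)"
    using assms(1) by (auto simp: fd_rel_def equiv_def intro!: symI transI dest: symD transD)
qed (auto simp: fd_rel_def)

lemma in_block_iff:
  assumes "equiv A r"
  shows "(x, y) \<in> r \<longleftrightarrow> (\<exists>B\<in>A // r. x \<in> B \<and> y \<in> B)"
proof
  assume "(x, y) \<in> r"
  then have "x \<in> A" "x \<in> r `` {x}" "y \<in> r `` {x}"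
    using assms by (auto simp: equiv_def refl_on_def)
  then show "\<exists>B\<in>A // r. x \<in> B \<and> y \<in> B" by (auto intro: quotientI)
next
  assume "\<exists>B\<in>A // r. x \<in> B \<and> y \<in> B"
  then obtain B where B: "B \<in> A // r" "x \<in> B" "y \<in> B" by blast
  from quotient_eq_iff[OF assms B(1) B(1) B(2,3)] show "(x, y) \<in> r" by blast
qed

lemma same_block_quotient: "equiv A r \<Longrightarrow> same_block (A // r) = r"
  unfolding same_block_def by (subst in_block_iff[symmetric]) auto

lemma same_block_fd_partition:
  "equiv {1..n} e \<Longrightarrow> (\<And>x. x \<in> {1..n} \<Longrightarrow> f x \<in> {1..n}) \<Longrightarrow>
    same_block (fd_partition n f e) = fd_rel n f e"
  unfolding fd_partition_def by (rule same_block_quotient[OF equiv_part_rel])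

text \<open>The trace on the lower row recovers \<open>e\<close>, and the block of
  \<open>Upper x\<close> recovers the class of \<open>f x\<close>. The map itself is thus determined
  only modulo \<open>e\<close>.\<close>

lemma fd_partition_eq_iff:
  assumes "equiv {1..n} e" "\<And>x. x \<in> {1..n} \<Longrightarrow> f x \<in> {1..n}"
    and "equiv {1..n} e'" "\<And>x. x \<in> {1..n} \<Longrightarrow> f' x \<in> {1..n}"
  shows "fd_partition n f e = fd_partition n f' e' \<longleftrightarrow> e = e' \<and> (\<forall>x\<in>{1..n}. (f x, f' x) \<in> e)"
proof
  assume "fd_partition n f e = fd_partition n f' e'"
  then have r: "fd_rel n f e = fd_rel n f' e'"
    using same_block_fd_partition[of n e f] same_block_fd_partition[of n e' f'] assms by simp
  have e: "e = {(x, y). (Lower x, Lower y) \<in> fd_rel n g e}" if "equiv {1..n} e" for e g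
    using that by (auto simp: fd_rel_def points_def equiv_def)
  have "e = e'" using e[OF assms(1), of f] e[OF assms(3), of f'] r by simp
  moreover have "(f x, f' x) \<in> e" if "x \<in> {1..n}" for x
  proof -
    have "(Upper x, Lower (f' x)) \<in> fd_rel n f' e'"
      using that assms(3,4) by (auto simp: fd_rel_def points_def equiv_def refl_on_def)
    then show ?thesis unfolding r[symmetric] by (simp add: fd_rel_def)
  qed
  ultimately show "e = e' \<and> (\<forall>x\<in>{1..n}. (f x, f' x) \<in> e)" by blast
next
  assume *: "e = e' \<and> (\<forall>x\<in>{1..n}. (f x, f' x) \<in> e)"
  have "(anchor f p, anchor f' p) \<in> e" if "p \<in> points n" for p
    using that * assms(1) by (auto simp: points_def equiv_def refl_on_def)
  then have "fd_rel n f e = fd_rel n f' e'"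
    using * assms(1) unfolding fd_rel_def equiv_def
    by auto (meson symD transD)+
  then show "fd_partition n f e = fd_partition n f' e'" by (simp add: fd_partition_def)
qed

lemma same_block_image: "same_block ((`) h ` a) = map_prod h h ` same_block a"
  by (auto simp: same_block_def image_iff)

text \<open>The smallest equivalence on the three rows is pinned from both sides: an explicit
  relation \<open>r\<close> bounds it from above, and every admissible \<open>s\<close> links each
  point to its anchor in the lower row, where \<open>s\<close> contains \<open>?J\<close>.\<close>

lemma pmult_fd_partition:
  assumes f: "\<And>x. x \<in> {1..n} \<Longrightarrow> f x \<in> {1..n}" and g: "\<And>x. x \<in> {1..n} \<Longrightarrow> g x \<in> {1..n}"
    and A: "A \<subseteq> {1..n} \<times> {1..n}" and B: "B \<subseteq> {1..n} \<times> {1..n}"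
  shows "pmult n (fd_partition n f (equiv_cl n A)) (fd_partition n g (equiv_cl n B))
    = fd_partition n (g \<circ> f) (equiv_cl n (map_prod g g ` A \<union> B))"
proof -
  let ?J = "equiv_cl n (map_prod g g ` A \<union> B)"
  have J: "equiv {1..n} ?J" by (rule equiv_equiv_cl) (use A B g in auto)
  have AJ: "(g x, g y) \<in> ?J" if "(x, y) \<in> equiv_cl n A" for x y
  proof -
    have "map_prod g g ` A \<subseteq> ?J" by (auto intro: equiv_cl_base)
    then show ?thesis using equiv_cl_map[where g = g, OF that g] equiv_cl_mono by blast
  qed
  have BJ: "(x, y) \<in> ?J" if "(x, y) \<in> equiv_cl n B" for x y
  proof -
    have "B \<subseteq> ?J" by (auto intro: equiv_cl_base)
    then show ?thesis using that equiv_cl_mono by blast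
  qed
  have sb: "same_block (down (fd_partition n f (equiv_cl n A))) = map_prod lower_to_middle lower_to_middle ` fd_rel n f (equiv_cl n A)"
    "same_block (up (fd_partition n g (equiv_cl n B))) = map_prod upper_to_middle upper_to_middle ` fd_rel n g (equiv_cl n B)"
    unfolding down_def up_def same_block_image
    by (simp_all add: same_block_fd_partition f g equiv_equiv_cl A B)
  \<comment> \<open>\<open>H\<close> transports each of the three rows to the lower one along
    \<open>f\<close> and \<open>g\<close>, so that \<open>r\<close> is the pullback of
    \<open>?J\<close>.\<close>
  define H where "H p = (case p of Upper x \<Rightarrow> g (f x) | Middle x \<Rightarrow> g x | Lower x \<Rightarrow> x)" for p
  define r where "r = {(p, q) \<in> points3 n \<times> points3 n. (H p, H q) \<in> ?J}"
  have "H p \<in> {1..n}" if "p \<in> points3 n" for p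
    using that f g by (auto simp: H_def points3_def)
  then have "equiv (points3 n) r"
    using J unfolding r_def equiv_def
    by (auto simp: refl_on_def intro!: symI transI dest: symD transD)
  moreover have "same_block (down (fd_partition n f (equiv_cl n A))) \<subseteq> r"
    unfolding sb by (auto simp: fd_rel_def points_def points3_def r_def H_def AJ)
  moreover have "same_block (up (fd_partition n g (equiv_cl n B))) \<subseteq> r"
    unfolding sb by (auto simp: fd_rel_def points_def points3_def r_def H_def BJ)
  ultimately have sub: "product_equiv n (fd_partition n f (equiv_cl n A)) (fd_partition n g (equiv_cl n B)) \<subseteq> r"
    unfolding product_equiv_def by blast
  have sup: "fd_rel n (g \<circ> f) ?J \<subseteq> s"
    if s: "equiv (points3 n) s"
      "same_block (down (fd_partition n f (equiv_cl n A))) \<subseteq> s" "same_block (up (fd_partition n g (equiv_cl n B))) \<subseteq> s" for s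
  proof -
    have s': "sym s" "trans s" using s(1) by (auto simp: equiv_def)
    have dn: "(lower_to_middle p, lower_to_middle q) \<in> s" if "(p, q) \<in> fd_rel n f (equiv_cl n A)" for p q
      using that s(2) unfolding sb by force
    have up: "(upper_to_middle p, upper_to_middle q) \<in> s" if "(p, q) \<in> fd_rel n g (equiv_cl n B)" for p q
      using that s(3) unfolding sb by force
    have mid_low: "(Middle x, Lower (g x)) \<in> s" if "x \<in> {1..n}" for x
      using up[of "Upper x" "Lower (g x)"] that g by (auto simp: fd_rel_def points_def intro: equiv_cl_refl)
    have upp_mid: "(Upper x, Middle (f x)) \<in> s" if "x \<in> {1..n}" for x
      using dn[of "Upper x" "Lower (f x)"] that f by (auto simp: fd_rel_def points_def intro: equiv_cl_refl)
    \<comment> \<open>The trace of \<open>s\<close> on the lower row is an equivalence; it contains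
      the generators of \<open>?J\<close> and hence all of \<open>?J\<close>.\<close>
    define d where "d = {(x, y) \<in> {1..n} \<times> {1..n}. (Lower x, Lower y) \<in> s}"
    have d: "equiv {1..n} d"
      using s(1) unfolding d_def equiv_def
      by (auto simp: refl_on_def points3_def intro!: symI transI dest: symD transD)
    have "(g x, g y) \<in> d" if "(x, y) \<in> A" for x y
    proof -
      have xy: "x \<in> {1..n}" "y \<in> {1..n}" using that A by auto
      have "(Middle x, Middle y) \<in> s"
        using dn[of "Lower x" "Lower y"] that xy by (auto simp: fd_rel_def points_def intro: equiv_cl_base)
      then have "(Lower (g x), Lower (g y)) \<in> s"
        using mid_low xy s' by (meson symD transD)
      then show ?thesis using xy g by (simp add: d_def)
    qed
    moreover have "(x, y) \<in> d" if "(x, y) \<in> B" for x y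
      using up[of "Lower x" "Lower y"] that B by (auto simp: fd_rel_def points_def d_def intro: equiv_cl_base)
    ultimately have Jd: "?J \<subseteq> d" by (intro equiv_cl_least[OF d]) auto
    have "(p, Lower (anchor (g \<circ> f) p)) \<in> s" if "p \<in> points n" for p
    proof (cases p)
      case (Upper x)
      then have "x \<in> {1..n}" using that by (auto simp: points_def)
      then show ?thesis using upp_mid[of x] mid_low[of "f x"] f s' Upper by (auto dest: transD)
    next
      case (Lower x)
      then show ?thesis using that s(1) by (auto simp: equiv_def refl_on_def points_def points3_def)
    qed (use that in \<open>auto simp: points_def\<close>)
    moreover have "(Lower x, Lower y) \<in> s" if "(x, y) \<in> ?J" for x y
      using that Jd by (auto simp: d_def)
    ultimately show "fd_rel n (g \<circ> f) ?J \<subseteq> s"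
      unfolding fd_rel_def using s' by (auto; meson symD transD)
  qed
  have "product_equiv n (fd_partition n f (equiv_cl n A)) (fd_partition n g (equiv_cl n B)) \<inter> points n \<times> points n
      = fd_rel n (g \<circ> f) ?J"
  proof
    show "product_equiv n (fd_partition n f (equiv_cl n A)) (fd_partition n g (equiv_cl n B)) \<inter> points n \<times> points n
        \<subseteq> fd_rel n (g \<circ> f) ?J"
      using sub by (auto simp: r_def fd_rel_def H_def points_def)
    show "fd_rel n (g \<circ> f) ?J
        \<subseteq> product_equiv n (fd_partition n f (equiv_cl n A)) (fd_partition n g (equiv_cl n B)) \<inter> points n \<times> points n"
      using sup unfolding product_equiv_def by (auto simp: fd_rel_def)
  qed
  then show ?thesis by (simp add: pmult_def fd_partition_def)
qed

section \<open>Images of letters and words\<close>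

lemma alphabet_eq:
  "alphabet n = {E i j |i j. i \<in> {1..n} \<and> j \<in> {1..n} \<and> i \<noteq> j} \<union>
    {T i j |i j. i \<in> {1..n} \<and> j \<in> {1..n} \<and> i \<noteq> j}"
proof -
  have "\<exists>i' j'. E i j = E i' j' \<and> 1 \<le> i' \<and> i' < j' \<and> j' \<le> n"
    if "i \<in> {1..n}" "j \<in> {1..n}" "i \<noteq> j" for i j
  proof (cases "i < j")
    case False
    then have "E i j = E j i \<and> 1 \<le> j \<and> j < i \<and> i \<le> n"
      using that by (simp add: atLeastAtMost_iff insert_commute)
    then show ?thesis by blast
  qed (use that in \<open>force simp: atLeastAtMost_iff\<close>)
  then have "{E i j |i j. i \<in> {1..n} \<and> j \<in> {1..n} \<and> i \<noteq> j} \<subseteq> {E i j |i j. 1 \<le> i \<and> i < j \<and> j \<le> n}"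
    by blast
  moreover have "{E i j |i j. 1 \<le> i \<and> i < j \<and> j \<le> n} \<subseteq> {E i j |i j. i \<in> {1..n} \<and> j \<in> {1..n} \<and> i \<noteq> j}"
  proof
    fix a assume "a \<in> {E i j |i j. 1 \<le> i \<and> i < j \<and> j \<le> n}"
    then obtain i j where "a = E i j" "1 \<le> i" "i < j" "j \<le> n" by blast
    then show "a \<in> {E i j |i j. i \<in> {1..n} \<and> j \<in> {1..n} \<and> i \<noteq> j}"
      by (intro CollectI exI[of _ i] exI[of _ j]) (simp add: atLeastAtMost_iff)
  qed
  moreover have "{T i j |i j. 1 \<le> i \<and> i < j \<and> j \<le> n} \<union> {T j i |i j. 1 \<le> i \<and> i < j \<and> j \<le> n}
      = {T i j |i j. i \<in> {1..n} \<and> j \<in> {1..n} \<and> i \<noteq> j}"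
    by (auto simp: atLeastAtMost_iff)
  ultimately show ?thesis unfolding alphabet_def by (simp add: Un_assoc subset_antisym)
qed

lemma quotient_image: "A // r = (\<lambda>x. r `` {x}) ` A"
  by (auto simp: quotient_def)

lemma letter_image_fd_partition:
  assumes "a \<in> alphabet n"
  shows "letter_image n a = fd_partition n (act a) (equiv_cl n (letter_pairs a))"
  using assms unfolding alphabet_eq
proof (elim UnE CollectE exE conjE)
  fix i j assume a: "a = E i j" and ij: "i \<in> {1..n}" "j \<in> {1..n}" "i \<noteq> j"
  have "equiv {1..n} (Id_on {1..n} \<union> {i, j} \<times> {i, j})"
    using ij by (intro equivI) (auto intro!: refl_onI symI transI)
  then have cl: "equiv_cl n (letter_pairs a) = Id_on {1..n} \<union> {i, j} \<times> {i, j}"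
    using a equiv_cl_least[of n _ "letter_pairs a"] by (auto intro: equiv_cl.intros)
  let ?r = "fd_rel n (act a) (equiv_cl n (letter_pairs a))"
  \<comment> \<open>\<open>?g p\<close> is the expected block of \<open>p\<close>;
    \<open>anchor id p\<close> is the number carried by \<open>p\<close>, whatever its row.\<close>
  let ?g = "\<lambda>p. if p \<in> {Upper i, Upper j, Lower i, Lower j} then {Upper i, Upper j, Lower i, Lower j}
      else {Upper (anchor id p), Lower (anchor id p)}"
  have "?r `` {p} = ?g p" if "p \<in> points n" for p
    using that ij unfolding cl by (cases p) (auto simp: a fd_rel_def points_def)
  then have "fd_partition n (act a) (equiv_cl n (letter_pairs a)) = ?g ` points n"
    unfolding fd_partition_def quotient_image by simp
  also have "\<dots> = ebar n i j"
  proof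
    show "?g ` points n \<subseteq> ebar n i j" using ij by (auto simp: points_def ebar_def)
    show "ebar n i j \<subseteq> ?g ` points n"
    proof
      fix B assume "B \<in> ebar n i j"
      then consider "B = ?g (Upper i)"
        | x where "x \<in> {1..n} - {i, j}" "B = ?g (Upper x)"
        by (auto simp: ebar_def)
      moreover have "Upper x \<in> points n" "Lower x \<in> points n" if "x \<in> {1..n}" for x
        using that by (auto simp: points_def)
      ultimately show "B \<in> ?g ` points n"
        using ij by cases (blast intro: image_eqI)+
    qed
  qed
  finally show ?thesis using letter_image_E a by simp
next
  fix i j assume a: "a = T i j" and ij: "i \<in> {1..n}" "j \<in> {1..n}" "i \<noteq> j"
  have cl: "equiv_cl n (letter_pairs a) = Id_on {1..n}" by (rule equiv_cl_Id) (simp_all add: a)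
  let ?r = "fd_rel n (act a) (equiv_cl n (letter_pairs a))"
  let ?g = "\<lambda>p. if p = Lower j then {Lower j} else if p \<in> {Upper i, Upper j, Lower i}
      then {Upper i, Upper j, Lower i} else {Upper (anchor id p), Lower (anchor id p)}"
  have "?r `` {p} = ?g p" if "p \<in> points n" for p
    using that ij unfolding cl by (cases p) (auto simp: a fd_rel_def points_def split: if_splits)
  then have "fd_partition n (act a) (equiv_cl n (letter_pairs a)) = ?g ` points n"
    unfolding fd_partition_def quotient_image by simp
  also have "\<dots> = tbar n i j"
  proof
    show "?g ` points n \<subseteq> tbar n i j" using ij by (auto simp: points_def tbar_def)
    show "tbar n i j \<subseteq> ?g ` points n"
    proof
      fix B assume "B \<in> tbar n i j"
      then consider "B = ?g (Upper i) \<or> B = ?g (Lower j)"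
        | x where "x \<in> {1..n} - {i, j}" "B = ?g (Upper x)"
        by (auto simp: tbar_def)
      moreover have "Upper x \<in> points n" "Lower x \<in> points n" if "x \<in> {1..n}" for x
        using that by (auto simp: points_def)
      ultimately show "B \<in> ?g ` points n"
        using ij by cases (blast intro: image_eqI)+
    qed
  qed
  finally show ?thesis using a by simp
qed

lemma act_in: "a \<in> alphabet n \<Longrightarrow> x \<in> {1..n} \<Longrightarrow> act a x \<in> {1..n}"
  by (auto simp: alphabet_eq)

lemma word_map_in': "w \<in> lists (alphabet n) \<Longrightarrow> x \<in> {1..n} \<Longrightarrow> word_map w x \<in> {1..n}"
  by (induction w arbitrary: x) (auto simp: act_in)

lemma letter_pairs_sub: "a \<in> alphabet n \<Longrightarrow> letter_pairs a \<subseteq> {1..n} \<times> {1..n}"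
  by (auto simp: alphabet_eq)

lemma word_pairs_sub: "w \<in> lists (alphabet n) \<Longrightarrow> word_pairs w \<subseteq> {1..n} \<times> {1..n}"
proof (induction w)
  case (Cons a w)
  then have a: "letter_pairs a \<subseteq> {1..n} \<times> {1..n}" and w: "\<And>x. x \<in> {1..n} \<Longrightarrow> word_map w x \<in> {1..n}"
    by (auto simp: word_map_in' letter_pairs_sub)
  have "map_prod (word_map w) (word_map w) ` letter_pairs a \<subseteq> {1..n} \<times> {1..n}"
    using a w by auto
  then show ?case using Cons by simp
qed simp

text \<open>Letters are appended on the right to match the \<open>foldl\<close> in
  \<open>word_morphism\<close>. The induction starts at single letters, because the empty word has
  no meaningful image.\<close>

lemma phi_fd_partition:
  "w \<in> free_semigroup (alphabet n) \<Longrightarrow> \<phi> n w = fd_partition n (word_map w) (equiv_cl n (word_pairs w))"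
proof (induction w rule: rev_induct)
  case (snoc a w)
  then have a: "a \<in> alphabet n" and w: "w \<in> lists (alphabet n)"
    by (auto simp: free_semigroup_def)
  show ?case
  proof (cases "w = []")
    case True
    then show ?thesis using letter_image_fd_partition[OF a]
      by (simp add: \<phi>_def word_morphism_def image_Un map_prod.id)
  next
    case False
    then have "\<phi> n (w @ [a]) = pmult n (\<phi> n w) (letter_image n a)"
      by (simp add: \<phi>_def word_morphism_def)
    also have "\<phi> n w = fd_partition n (word_map w) (equiv_cl n (word_pairs w))"
      by (rule snoc.IH) (use w False in \<open>auto simp: free_semigroup_def\<close>)
    also have "pmult n \<dots> (letter_image n a)
        = fd_partition n (act a \<circ> word_map w) (equiv_cl n (map_prod (act a) (act a) ` word_pairs w \<union> letter_pairs a))"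
      unfolding letter_image_fd_partition[OF a]
      by (rule pmult_fd_partition) (use a w in \<open>simp_all add: word_map_in' act_in word_pairs_sub letter_pairs_sub\<close>)
    finally show ?thesis by (simp add: comp_def map_prod.id)
  qed
qed (simp add: free_semigroup_def)

lemma phi_append:
  assumes "u \<in> free_semigroup (alphabet n)" "v \<in> free_semigroup (alphabet n)"
  shows "\<phi> n (u @ v) = pmult n (\<phi> n u) (\<phi> n v)"
proof -
  have uv: "u \<in> lists (alphabet n)" "v \<in> lists (alphabet n)" "u @ v \<in> free_semigroup (alphabet n)"
    using assms by (auto simp: free_semigroup_def)
  show ?thesis unfolding phi_fd_partition[OF uv(3)] phi_fd_partition[OF assms(1)] phi_fd_partition[OF assms(2)]
    by (subst pmult_fd_partition) (use uv in \<open>simp_all add: word_map_in' word_pairs_sub comp_def\<close>)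
qed

text \<open>This turns both soundness and completeness of the relations into statements about maps
  and generated equivalences.\<close>

lemma phi_eq_iff:
  assumes "u \<in> free_semigroup (alphabet n)" "v \<in> free_semigroup (alphabet n)"
  shows "\<phi> n u = \<phi> n v \<longleftrightarrow>
    equiv_cl n (word_pairs u) = equiv_cl n (word_pairs v) \<and> (\<forall>x\<in>{1..n}. (word_map u x, word_map v x) \<in> equiv_cl n (word_pairs u))"
proof -
  have uv: "u \<in> lists (alphabet n)" "v \<in> lists (alphabet n)"
    using assms by (auto simp: free_semigroup_def)
  show ?thesis unfolding phi_fd_partition[OF assms(1)] phi_fd_partition[OF assms(2)]
    by (rule fd_partition_eq_iff) (use uv in \<open>simp_all add: word_map_in' word_pairs_sub equiv_equiv_cl\<close>)
qed

lemma relations_free: "relations n \<subseteq> free_semigroup (alphabet n) \<times> free_semigroup (alphabet n)"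
proof (rule subrelI)
  fix u v assume "(u, v) \<in> relations n"
  then show "(u, v) \<in> free_semigroup (alphabet n) \<times> free_semigroup (alphabet n)"
    by cases (auto simp: free_semigroup_def alphabet_eq)
qed

lemma relations_sound:
  assumes "(u, v) \<in> relations n" 
  shows "\<phi> n u = \<phi> n v"
proof -
  have "u \<in> free_semigroup (alphabet n)" "v \<in> free_semigroup (alphabet n)"
    using assms relations_free by auto
  moreover have "word_pairs u \<subseteq> equiv_cl n (word_pairs v) \<and> word_pairs v \<subseteq> equiv_cl n (word_pairs u) \<and> (\<forall>x\<in>{1..n}. (word_map u x, word_map v x) \<in> equiv_cl n (word_pairs u))"
    using assms
  proof cases
    \<comment> \<open>Two sides of a triangle generate the third, which takes transitivity; in the
      other relations the pairs match directly or are diagonal.\<close>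
    case (ee2 i j k)
    have "{(i, j), (j, k)} \<subseteq> word_pairs u" "{(j, k), (k, i)} \<subseteq> word_pairs v"
      unfolding ee2(1,2) by simp_all
    then have "(i, k) \<in> equiv_cl n (word_pairs u)" "(i, j) \<in> equiv_cl n (word_pairs v)"
      using equiv_cl_trans[OF equiv_cl_base equiv_cl_base, of i j "word_pairs u" k n]
        equiv_cl_sym[OF equiv_cl_trans[OF equiv_cl_base equiv_cl_base, of j k "word_pairs v" i n]] by auto
    then show ?thesis unfolding ee2(1,2)
      by (auto intro: equiv_cl_base equiv_cl_sym equiv_cl_refl)
  qed (auto intro: equiv_cl_base equiv_cl_refl)
  ultimately show ?thesis by (simp add: phi_eq_iff equiv_cl_eqI)
qed

section \<open>Full-domain elements and permutations in terms of maps and equivalences\<close>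

lemma fd_partition_full_domain:
  assumes "equiv {1..n} e" "\<And>x. x \<in> {1..n} \<Longrightarrow> f x \<in> {1..n}"
  shows "fd_partition n f e \<in> full_domain n"
proof -
  have "\<exists>B\<in>fd_partition n f e. Upper x \<in> B \<and> (\<exists>y\<in>{1..n}. Lower y \<in> B)" if "x \<in> {1..n}" for x
  proof -
    have "(Upper x, Lower (f x)) \<in> same_block (fd_partition n f e)"
      using that assms by (auto simp: same_block_fd_partition fd_rel_def points_def equiv_def refl_on_def)
    then show ?thesis using assms(2)[OF that] by (auto simp: same_block_def)
  qed
  moreover have "partition_on (points n) (fd_partition n f e)"
    unfolding fd_partition_def by (rule partition_on_quotient[OF equiv_part_rel[OF assms]])
  ultimately show ?thesis by (auto simp: full_domain_def partition_monoid_def)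
qed

text \<open>Choose for \<open>f x\<close> any lower point in the block of \<open>Upper x\<close>,
  and let \<open>e\<close> be the trace on the lower row. Each point then shares its block with its
  anchor, so the anchors decide which points are related.\<close>

lemma full_domain_fd_partition:
  assumes "a \<in> full_domain n"
  obtains f e where "equiv {1..n} e" "\<And>x. x \<in> {1..n} \<Longrightarrow> f x \<in> {1..n}" "a = fd_partition n f e"
proof -
  let ?r = "same_block a"
  have P: "partition_on (points n) a" using assms by (simp add: full_domain_def partition_monoid_def)
  have r: "equiv (points n) ?r" using equiv_partition_on[OF P] by (simp add: same_block_def)
  have a: "points n // ?r = a" using partition_on_eq_quotient[OF P] by (simp add: same_block_def)
  have "\<exists>y. y \<in> {1..n} \<and> (Upper x, Lower y) \<in> ?r" if "x \<in> {1..n}" for x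
    using assms that unfolding full_domain_def same_block_def by blast
  then obtain f where f: "\<And>x. x \<in> {1..n} \<Longrightarrow> f x \<in> {1..n} \<and> (Upper x, Lower (f x)) \<in> ?r" by metis
  define e where "e = {(x, y). x \<in> {1..n} \<and> y \<in> {1..n} \<and> (Lower x, Lower y) \<in> ?r}"
  have "equiv {1..n} e"
    using r unfolding e_def equiv_def
    by (auto simp: points_def refl_on_def intro!: symI transI dest: symD transD)
  have anchor: "(p, Lower (anchor f p)) \<in> ?r \<and> anchor f p \<in> {1..n}" if "p \<in> points n" for p
    using that f r by (auto simp: points_def equiv_def refl_on_def)
  have "fd_rel n f e = ?r"
  proof (rule set_eqI, clarify)
    fix p q
    have "(p, q) \<in> ?r \<longleftrightarrow> (Lower (anchor f p), Lower (anchor f q)) \<in> ?r" if "p \<in> points n" "q \<in> points n"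
      using anchor[OF that(1)] anchor[OF that(2)] r unfolding equiv_def by (meson symD transD)
    moreover have "p \<in> points n \<and> q \<in> points n" if "(p, q) \<in> ?r" using that r by (auto simp: equiv_def)
    ultimately show "(p, q) \<in> fd_rel n f e \<longleftrightarrow> (p, q) \<in> ?r"
      using anchor by (auto simp: fd_rel_def e_def)
  qed
  then have "a = fd_partition n f e" using a by (simp add: fd_partition_def)
  then show thesis using that \<open>equiv {1..n} e\<close> f by blast
qed

lemma permutation_fd_partition:
  assumes "g permutes {1..n}"
  shows "{{Upper x, Lower (g x)} |x. x \<in> {1..n}} = fd_partition n g (Id_on {1..n})"
proof -
  let ?r = "fd_rel n g (Id_on {1..n})"
  have g: "g x \<in> {1..n} \<longleftrightarrow> x \<in> {1..n}" for x using assms by (rule permutes_in_image)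
  have inj: "g x = g y \<longleftrightarrow> x = y" for x y using permutes_inj[OF assms] by (auto dest: injD)
  have U: "?r `` {Upper x} = {Upper x, Lower (g x)}" if "x \<in> {1..n}" for x
    using that by (auto simp: fd_rel_def points_def g inj)
  have L: "?r `` {Lower (g x)} = {Upper x, Lower (g x)}" if "x \<in> {1..n}" for x
    using that by (auto simp: fd_rel_def points_def g inj)
  have "points n = Upper ` {1..n} \<union> (\<lambda>x. Lower (g x)) ` {1..n}"
    using permutes_image[OF assms] by (auto simp: points_def image_iff)
  then have "fd_partition n g (Id_on {1..n}) = (\<lambda>x. {Upper x, Lower (g x)}) ` {1..n}"
    unfolding fd_partition_def quotient_image by (simp add: image_Un image_image U L)
  then show ?thesis by blast
qed

lemma fd_partition_sym_iff:
  assumes "equiv {1..n} e" and f: "\<And>x. x \<in> {1..n} \<Longrightarrow> f x \<in> {1..n}"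
  shows "fd_partition n f e \<in> sym_partitions n \<longleftrightarrow> e = Id_on {1..n} \<and> inj_on f {1..n}"
proof
  have Id: "equiv {1..n} (Id_on {1..n})" by (intro equivI refl_onI symI transI) auto
  {
    assume "fd_partition n f e \<in> sym_partitions n"
    then obtain g where g: "g permutes {1..n}" "fd_partition n f e = fd_partition n g (Id_on {1..n})"
      using permutation_fd_partition by (auto simp: sym_partitions_def)
    then have e: "e = Id_on {1..n}" and fg: "\<And>x. x \<in> {1..n} \<Longrightarrow> (f x, g x) \<in> e"
      using fd_partition_eq_iff[where f = f and f' = g, OF assms Id] permutes_in_image[OF g(1)] by auto
    have "f x = g x" if "x \<in> {1..n}" for x using fg[OF that] e by auto
    then have "inj_on f {1..n}"
      using permutes_inj_on[OF g(1), of "{1..n}"] by (simp cong: inj_on_cong)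
    then show "e = Id_on {1..n} \<and> inj_on f {1..n}" using e by simp
  next
    assume *: "e = Id_on {1..n} \<and> inj_on f {1..n}"
    \<comment> \<open>Since \<open>permutes\<close> requires the identity outside
      \<open>{1..n}\<close>, the map is extended accordingly.\<close>
    define g where "g x = (if x \<in> {1..n} then f x else x)" for x
    have "f ` {1..n} = {1..n}" using * f by (intro endo_inj_surj) auto
    then have "bij_betw g {1..n} {1..n}" using * by (auto simp: bij_betw_def g_def inj_on_def)
    then have g: "g permutes {1..n}" by (rule bij_imp_permutes) (simp add: g_def)
    have "fd_partition n f e = fd_partition n g (Id_on {1..n})"
      using fd_partition_eq_iff[where f = f and f' = g, OF assms Id] * f by (auto simp: g_def)
    then show "fd_partition n f e \<in> sym_partitions n"
      using g permutation_fd_partition[OF g] by (auto simp: sym_partitions_def)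
  }
qed

subsection \<open>Words in the letters \<open>T i j\<close> as sliding tokens\<close>

lemma transpose_eq_iff:
  "Transposition.transpose a b x = a \<longleftrightarrow> x = b" "Transposition.transpose a b x = b \<longleftrightarrow> x = a"
  "Transposition.transpose a b x = Transposition.transpose a b y \<longleftrightarrow> x = y"
  by (auto simp: transpose_def)

locale fixed_degree =
  fixes n :: nat
begin

definition img :: "letter list \<Rightarrow> nat set" where
  "img w = word_map w ` {1..n}"

definition tword :: "letter list \<Rightarrow> bool" where
  "tword w \<longleftrightarrow> set w \<subseteq> {T i j |i j. i \<in> {1..n} \<and> j \<in> {1..n} \<and> i \<noteq> j}"

definition eword :: "letter list \<Rightarrow> bool" where
  "eword w \<longleftrightarrow> set w \<subseteq> {E i j |i j. i \<in> {1..n} \<and> j \<in> {1..n} \<and> i \<noteq> j}"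

lemma tword_simps [simp]:
  "tword []"
  "tword (a # w) \<longleftrightarrow> (\<exists>i j. a = T i j \<and> i \<in> {1..n} \<and> j \<in> {1..n} \<and> i \<noteq> j) \<and> tword w"
  "tword (u @ v) \<longleftrightarrow> tword u \<and> tword v"
  by (auto simp: tword_def)

lemma eword_simps [simp]:
  "eword []"
  "eword (a # w) \<longleftrightarrow> (\<exists>i j. a = E i j \<and> i \<in> {1..n} \<and> j \<in> {1..n} \<and> i \<noteq> j) \<and> eword w"
  "eword (u @ v) \<longleftrightarrow> eword u \<and> eword v"
  by (auto simp: eword_def)

lemma word_map_in: "tword w \<Longrightarrow> x \<in> {1..n} \<Longrightarrow> word_map w x \<in> {1..n}"
proof (induction w arbitrary: x)
  case (Cons a w)
  have "act a x \<in> {1..n}" using Cons.prems by auto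
  then show ?case using Cons.IH[of "act a x"] Cons.prems by simp
qed simp

lemma img_snoc: "img (p @ [a]) = act a ` img p"
  by (auto simp: img_def)

lemma img_sub: "tword w \<Longrightarrow> img w \<subseteq> {1..n}"
  using word_map_in by (auto simp: img_def)

lemma img_slide: "i \<noteq> j \<Longrightarrow> j \<notin> img (p @ [T i j])"
  by (auto simp: img_snoc)

text \<open>
  The contexts \<open>a\<close>, \<open>b\<close> may contain letters outside the alphabet, so that \<open>eqv\<close> is a congruence without
  side conditions; on words over the alphabet it is the congruence generated by the relations.
\<close>

inductive eqv :: "letter list \<Rightarrow> letter list \<Rightarrow> bool" (infix "\<approx>" 50) where
  eqv_base: "(u, v) \<in> relations n \<Longrightarrow> a @ u @ b \<approx> a @ v @ b"
| eqv_refl [simp]: "u \<approx> u"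
| eqv_sym: "u \<approx> v \<Longrightarrow> v \<approx> u"
| eqv_trans [trans]: "u \<approx> v \<Longrightarrow> v \<approx> w \<Longrightarrow> u \<approx> w"

lemma eqv_rel: "(u, v) \<in> relations n \<Longrightarrow> u \<approx> v"
  using eqv_base[of u v "[]" "[]"] by simp

lemma eqv_ctx: "u \<approx> v \<Longrightarrow> a @ u @ b \<approx> a @ v @ b"
proof (induction rule: eqv.induct)
  case (eqv_base u v c d)
  then show ?case using eqv.eqv_base[of u v "a @ c" "d @ b"] by simp
qed (auto intro: eqv.intros)

lemma eqv_left: "u \<approx> v \<Longrightarrow> a @ u \<approx> a @ v"
  using eqv_ctx[of u v a "[]"] by simp

lemma eqv_right: "u \<approx> v \<Longrightarrow> u @ b \<approx> v @ b"
  using eqv_ctx[of u v "[]" b] by simp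

text \<open>\<open>T i j\<close> slides the token at \<open>j\<close> to \<open>i\<close>, and here
  there is none. The relations absorb the letter into the last letter of \<open>p\<close> or move it
  further left, where \<open>j\<close> is still empty. For the empty word every position is
  occupied.\<close>

lemma noop:
  assumes "tword p" "i \<in> {1..n}" "j \<in> {1..n}" "i \<noteq> j" "j \<notin> img p"
  shows "p @ [T i j] \<approx> p"
  using assms
proof (induction p arbitrary: i j rule: rev_induct)
  case Nil
  then show ?case by (auto simp: img_def)
next
  case (snoc a p)
  then obtain k l where a: "a = T k l" and kl: "k \<in> {1..n}" "l \<in> {1..n}" "k \<noteq> l" by auto
  have p: "tword p" using snoc.prems by simp
  note IH = snoc.IH[OF p]
  have im: "j \<notin> act (T k l) ` img p" using snoc.prems(5) by (simp add: img_snoc a)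
  have R: "p @ u \<approx> p @ v" if "(u, v) \<in> relations n" for u v
    by (rule eqv_left[OF eqv_rel[OF that]])
  consider "j = l" "i = k" | "j = l" "i \<noteq> k" | "j = k" | "j \<noteq> k" "j \<noteq> l" by blast
  then show ?case
  proof cases
    case 1
    then show ?thesis using R[OF tt1[of k l]] kl a by simp
  next
    case 2
    then show ?thesis using R[OF tt3[of k i j]] kl a snoc.prems by simp
  next
    case 3
    \<comment> \<open>\<open>T k l\<close> leaves \<open>k\<close> empty only if both positions were
      empty before, so \<open>T k l\<close> is itself trivial after \<open>p\<close>.\<close>
    have k: "k \<notin> img p" and l: "l \<notin> img p"
      using im 3 by (auto simp: image_iff split: if_splits)
    have "p @ [T k l] \<approx> p" by (rule IH) (use kl l in auto)
    moreover have "p @ [T i k] \<approx> p" by (rule IH) (use kl 3 k snoc.prems in auto)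
    moreover from \<open>p @ [T k l] \<approx> p\<close> have "p @ [T k l, T i k] \<approx> p @ [T i k]"
      using eqv_right[of _ _ "[T i k]"] by fastforce
    ultimately show ?thesis
      using a 3 by (metis append_Cons append_Nil append_assoc eqv_sym eqv_trans)
  next
    case 4
    have j: "j \<notin> img p" using im 4 by (force simp: image_iff)
    have ij: "p @ [T i j] \<approx> p" by (rule IH) (use j snoc.prems in auto)
    have kj: "p @ [T k j] \<approx> p" by (rule IH) (use j kl 4 snoc.prems in auto)
    consider "i = k" | "i = l" | "i \<noteq> k" "i \<noteq> l" by blast
    then show ?thesis
    proof cases
      case 1
      have "p @ [T k l, T k j] \<approx> p @ [T k j, T k l]"
        by (rule R[OF tt4]) (use kl 4 snoc.prems in auto)
      also have "\<dots> \<approx> p @ [T k l]" using eqv_right[OF kj, of "[T k l]"] by simp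
      finally show ?thesis using a 1 by simp
    next
      case 2
      \<comment> \<open>The trivial letter \<open>T k j\<close> is inserted so that, once moved past
        \<open>T k l\<close>, it absorbs \<open>T l j\<close> by \<open>tt3\<close>; afterwards it
        is moved back and removed.\<close>
      have "p @ [T k l, T l j] \<approx> p @ [T k j, T k l, T l j]"
        using eqv_sym[OF eqv_right[OF kj, of "[T k l, T l j]"]] by simp
      also have "\<dots> \<approx> p @ [T k l, T k j, T l j]"
        using eqv_ctx[OF eqv_rel[OF tt4[of k j l]], of p "[T l j]"] kl 4 snoc.prems by simp
      also have "\<dots> \<approx> p @ [T k l, T k j]"
        using eqv_left[OF eqv_rel[OF tt3[of k l j]], of "p @ [T k l]"] kl 4 snoc.prems by simp
      also have "\<dots> \<approx> p @ [T k j, T k l]"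
        by (rule R[OF tt4]) (use kl 4 snoc.prems in auto)
      also have "\<dots> \<approx> p @ [T k l]" using eqv_right[OF kj, of "[T k l]"] by simp
      finally show ?thesis using a 2 by simp
    next
      case 3
      have "p @ [T k l, T i j] \<approx> p @ [T i j, T k l]"
        by (rule R[OF tt_comm]) (use kl 3 4 snoc.prems in auto)
      also have "\<dots> \<approx> p @ [T k l]" using eqv_right[OF ij, of "[T k l]"] by simp
      finally show ?thesis using a by simp
    qed
  qed
qed

section \<open>Swapping two positions by means of an empty one\<close>

definition swap_word :: "nat \<Rightarrow> nat \<Rightarrow> nat \<Rightarrow> letter list" where
  "swap_word k i j = [T k i, T i j, T j k]"

definition hole :: "letter list \<Rightarrow> nat \<Rightarrow> bool" where
  "hole p k \<longleftrightarrow> tword p \<and> k \<in> {1..n} \<and> k \<notin> img p"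

lemma holeD: "hole p k \<Longrightarrow> tword p" "hole p k \<Longrightarrow> k \<in> {1..n}"
  by (simp_all add: hole_def)

lemma hole_noop: "hole p k \<Longrightarrow> i \<in> {1..n} \<Longrightarrow> i \<noteq> k \<Longrightarrow> p @ [T i k] \<approx> p"
  using noop by (simp add: hole_def)

lemma hole_slide: "hole p k \<Longrightarrow> l \<in> {1..n} \<Longrightarrow> l \<noteq> k \<Longrightarrow> hole (p @ [T k l]) l"
  using img_slide[of k l p] by (auto simp: hole_def)

text \<open>By \<open>tt2\<close> the round trip equals its second slide, which moves nothing
  because \<open>k\<close> is empty.\<close>

lemma slide_back:
  assumes "hole p k" "l \<in> {1..n}" "l \<noteq> k"
  shows "p @ [T k l, T l k] \<approx> p"
proof -
  have "p @ [T k l, T l k] \<approx> p @ [T l k]"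
    using eqv_left[OF eqv_sym[OF eqv_rel[OF tt2[of l k]]], of p] holeD[OF assms(1)] assms by simp
  also have "\<dots> \<approx> p" using assms by (rule hole_noop)
  finally show ?thesis .
qed

lemma hole_swap_word:
  assumes "hole p k" "{i, j} \<subseteq> {1..n}" "distinct [i, j, k]"
  shows "hole (p @ swap_word k i j) k"
  using hole_slide[of "p @ [T k i, T i j]" j k] hole_slide[of "p @ [T k i]" i j]
    hole_slide[of p k i] assms holeD[OF assms(1)] by (simp add: swap_word_def)

text \<open>The right-hand side of \<open>ttt\<close> is the other swap preceded by
  \<open>T i k\<close>, which is trivial as long as \<open>k\<close> is empty.\<close>

lemma swap_word_commute:
  assumes "hole p k" "{i, j} \<subseteq> {1..n}" "distinct [i, j, k]"
  shows "p @ swap_word k i j \<approx> p @ swap_word k j i"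
proof -
  have k: "k \<in> {1..n}" using assms holeD by blast
  have "p @ swap_word k i j \<approx> p @ [T i k, T k j, T j i, T i k]"
    unfolding swap_word_def by (rule eqv_left[OF eqv_rel[OF ttt]]) (use assms k in auto)
  also have "\<dots> \<approx> p @ swap_word k j i"
    using eqv_right[OF hole_noop[OF assms(1), of i], of "[T k j, T j i, T i k]"] assms
    by (simp add: swap_word_def)
  finally show ?thesis .
qed

text \<open>Moving the empty position past a swap renames the indices of the swap. For
  \<open>l\<close> outside \<open>{i, j}\<close> this is \<open>tttt\<close> up to a trivial letter;
  otherwise it is the symmetry of swaps, used after the slide if \<open>l = i\<close> and before it
  if \<open>l = j\<close>.\<close>

lemma swap_word_slide:
  assumes p: "hole p k" and ij: "{i, j} \<subseteq> {1..n}" "distinct [i, j, k]"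
    and l: "l \<in> {1..n}" "l \<noteq> k"
  shows "p @ swap_word k i j @ [T k l]
    \<approx> p @ [T k l] @ swap_word l (Transposition.transpose k l i) (Transposition.transpose k l j)"
proof -
  have k: "k \<in> {1..n}" using p holeD by blast
  consider "l = i" | "l = j" | "l \<noteq> i" "l \<noteq> j" by blast
  then show ?thesis
  proof cases
    case 1
    have "(p @ [T k i]) @ swap_word i j k \<approx> (p @ [T k i]) @ swap_word i k j"
      by (rule swap_word_commute) (use hole_slide p ij k in auto)
    then show ?thesis using 1 ij by (simp add: swap_word_def)
  next
    case 2
    have "p @ swap_word k i j \<approx> p @ swap_word k j i"
      by (rule swap_word_commute) (use p ij in auto)
    from eqv_right[OF this, of "[T k j]"] show ?thesis using 2 ij by (simp add: swap_word_def)
  next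
    case 3
    have "p @ swap_word k i j @ [T k l] \<approx> p @ [T i k, T k l] @ swap_word l i j"
      using eqv_left[OF eqv_rel[OF tttt[of i j k l]], of p] 3 ij l k by (simp add: swap_word_def)
    also have "\<dots> \<approx> p @ [T k l] @ swap_word l i j"
      using eqv_right[OF hole_noop[OF p, of i], of "[T k l] @ swap_word l i j"] ij by simp
    finally show ?thesis using 3 ij by simp
  qed
qed

text \<open>The second swap moves the empty position from \<open>k\<close> to \<open>a\<close>, to
  \<open>b\<close> and back to \<open>k\<close>. Each slide renames the first swap, and the
  composite of the three transpositions is that of \<open>a\<close> and \<open>b\<close> on points
  other than \<open>k\<close>.\<close>

lemma swap_word_conj:
  assumes p: "hole p k" and ij: "{i, j} \<subseteq> {1..n}" "distinct [i, j, k]"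
    and ab: "{a, b} \<subseteq> {1..n}" "distinct [a, b, k]"
  shows "p @ swap_word k i j @ swap_word k a b
    \<approx> p @ swap_word k a b @ swap_word k (Transposition.transpose a b i) (Transposition.transpose a b j)"
proof -
  let ?t = Transposition.transpose
  have k: "k \<in> {1..n}" using p holeD by blast
  have q: "hole (p @ [T k a]) a" "hole (p @ [T k a, T a b]) b"
    using hole_slide[of p k a] hole_slide[of "p @ [T k a]" a b] p ab k by auto
  have in_n: "?t x y z \<in> {1..n}" if "x \<in> {1..n}" "y \<in> {1..n}" "z \<in> {1..n}" for x y z
    using that by (auto simp: transpose_def)
  note eqv_right[OF swap_word_slide[OF p ij, of a], of "[T a b, T b k]"]
  then have "p @ swap_word k i j @ [T k a, T a b, T b k]
    \<approx> p @ [T k a] @ swap_word a (?t k a i) (?t k a j) @ [T a b, T b k]"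
    using ab by simp
  also have "\<dots> \<approx> p @ [T k a, T a b] @ swap_word b (?t a b (?t k a i)) (?t a b (?t k a j)) @ [T b k]"
    using eqv_right[OF swap_word_slide[OF q(1), of "?t k a i" "?t k a j" b], of "[T b k]"] ab ij k
    by (simp add: in_n transpose_eq_iff)
  also have "\<dots> \<approx> p @ [T k a, T a b, T b k] @
      swap_word k (?t b k (?t a b (?t k a i))) (?t b k (?t a b (?t k a j)))"
    using swap_word_slide[OF q(2), of "?t a b (?t k a i)" "?t a b (?t k a j)" k] ab ij k
    by (simp add: in_n transpose_eq_iff)
  also have "?t b k (?t a b (?t k a i)) = ?t a b i" using ij ab by (auto simp: transpose_def)
  also have "?t b k (?t a b (?t k a j)) = ?t a b j" using ij ab by (auto simp: transpose_def)
  finally show ?thesis by (simp add: swap_word_def)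
qed

text \<open>With the second swap rewritten as \<open>swap_word k j i\<close>, its slides undo those
  of the first in reverse order, and the product collapses from the inside by
  \<open>slide_back\<close>.\<close>

lemma swap_word_swap_word:
  assumes p: "hole p k" and ij: "{i, j} \<subseteq> {1..n}" "distinct [i, j, k]"
  shows "p @ swap_word k i j @ swap_word k i j \<approx> p"
proof -
  have k: "k \<in> {1..n}" using p holeD by blast
  have q: "hole (p @ [T k i]) i" "hole (p @ [T k i, T i j]) j"
    using hole_slide[of p k i] hole_slide[of "p @ [T k i]" i j] p ij k by auto
  have "(p @ swap_word k i j) @ swap_word k i j \<approx> (p @ swap_word k i j) @ swap_word k j i"
    by (rule swap_word_commute[OF hole_swap_word]) (use p ij in auto)
  also have "(p @ swap_word k i j) @ swap_word k j i
      = (p @ [T k i, T i j]) @ [T j k, T k j] @ [T j i, T i k]" by (simp add: swap_word_def)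
  also have "\<dots> \<approx> p @ [T k i, T i j, T j i, T i k]"
    using eqv_right[OF slide_back[OF q(2), of k], of "[T j i, T i k]"] ij k by simp
  also have "\<dots> \<approx> p @ [T k i, T i k]"
    using eqv_right[OF slide_back[OF q(1), of j], of "[T i k]"] ij k by simp
  also have "\<dots> \<approx> p"
    using slide_back[OF p, of i] ij by simp
  finally show ?thesis by simp
qed

section \<open>Soundness of derivations\<close>

lemma eqv_lists: "eqv u v \<Longrightarrow> u \<in> lists (alphabet n) \<longleftrightarrow> v \<in> lists (alphabet n)"
proof (induction rule: eqv.induct)
  case (eqv_base u v a b)
  then have "u \<in> lists (alphabet n)" "v \<in> lists (alphabet n)"
    using relations_free[of n] by (auto simp: free_semigroup_def)
  then show ?case by simp
qed auto

text \<open>A derivation that starts over the alphabet stays over it, so each step lies in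
  \<open>C\<close>. The disjunct \<open>u = v\<close> accounts for the empty word, about which
  \<open>C\<close> says nothing.\<close>

lemma eqv_congruence:
  assumes C: "congruence_on (free_semigroup (alphabet n)) (@) C" "relations n \<subseteq> C"
    and "eqv u v" "u \<in> lists (alphabet n)"
  shows "u = v \<or> (u, v) \<in> C"
  using assms(3,4)
proof (induction rule: eqv.induct)
  case (eqv_base u v a b)
  have ctx: "(c @ u', c @ v') \<in> C \<and> (u' @ c, v' @ c) \<in> C"
    if "(u', v') \<in> C" "c \<in> lists (alphabet n)" for c u' v'
    using C(1) that by (cases "c = []") (auto simp: congruence_on_def free_semigroup_def)
  have "(u, v) \<in> C" using eqv_base C(2) by auto
  then have "(a @ u, a @ v) \<in> C" using ctx eqv_base.prems by auto
  then show ?case using ctx[of "a @ u" "a @ v" b] eqv_base.prems by auto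
next
  case (eqv_sym u v)
  then show ?case using C(1) eqv_lists[of u v]
    by (auto simp: congruence_on_def equiv_def dest: symD)
next
  case (eqv_trans u v w)
  then show ?case using C(1) eqv_lists[of u v]
    by (auto simp: congruence_on_def equiv_def dest: transD)
qed simp

lemma kernel_congruence:
  "congruence_on (free_semigroup (alphabet n)) (@)
    {(u, v). u \<in> free_semigroup (alphabet n) \<and> v \<in> free_semigroup (alphabet n) \<and> \<phi> n u = \<phi> n v}"
proof -
  have "u @ v \<in> free_semigroup (alphabet n)"
    if "u \<in> free_semigroup (alphabet n)" "v \<in> free_semigroup (alphabet n)" for u v
    using that by (auto simp: free_semigroup_def)
  then show ?thesis
    by (auto simp: congruence_on_def phi_append intro!: equivI refl_onI symI transI)
qed

lemma eqv_sound:
  assumes "eqv u v" "u \<in> lists (alphabet n)"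
  shows "u = v \<or> u \<noteq> [] \<and> v \<noteq> [] \<and> \<phi> n u = \<phi> n v"
proof -
  have "relations n \<subseteq> {(u, v). u \<in> free_semigroup (alphabet n) \<and> v \<in> free_semigroup (alphabet n) \<and> \<phi> n u = \<phi> n v}"
    using relations_sound relations_free[of n] by blast
  from eqv_congruence[OF kernel_congruence this assms] show ?thesis
    by (auto simp: free_semigroup_def)
qed

lemma tword_lists: "tword w \<Longrightarrow> w \<in> lists (alphabet n)"
  by (auto simp: tword_def alphabet_eq)

lemma eword_lists: "eword w \<Longrightarrow> w \<in> lists (alphabet n)"
  by (auto simp: eword_def alphabet_eq)

lemma word_pairs_tword: "tword w \<Longrightarrow> word_pairs w = {}"
  by (induction w) auto

text \<open>Words in the letters \<open>T i j\<close> generate only the identity equivalence, so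
  agreement modulo it is equality of maps.\<close>

lemma tword_sound:
  assumes "eqv u v" "tword u" "tword v" "x \<in> {1..n}"
  shows "word_map u x = word_map v x"
proof (cases "u = v")
  case False
  then have "\<phi> n u = \<phi> n v" "u \<noteq> []" "v \<noteq> []"
    using eqv_sound[OF assms(1)] assms tword_lists by auto
  then have "(word_map u x, word_map v x) \<in> equiv_cl n (word_pairs u)"
    using phi_eq_iff[of u n v] assms tword_lists by (auto simp: free_semigroup_def)
  moreover have "equiv_cl n (word_pairs u) = Id_on {1..n}" using word_pairs_tword assms by (intro equiv_cl_Id) auto
  ultimately show ?thesis by auto
qed simp


section \<open>Products of swaps at a fixed empty position\<close>

lemma word_map_swap_word: "distinct [i, j, k] \<Longrightarrow> z \<noteq> k \<Longrightarrow> word_map (swap_word k i j) z = Transposition.transpose i j z"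
  by (auto simp: swap_word_def transpose_def)

fun swap_words :: "nat \<Rightarrow> (nat \<times> nat) list \<Rightarrow> letter list" where
  "swap_words k [] = []"
| "swap_words k ((i, j) # \<Sigma>) = swap_word k i j @ swap_words k \<Sigma>"

lemma swap_words_append [simp]: "swap_words k (\<Sigma> @ \<Sigma>') = swap_words k \<Sigma> @ swap_words k \<Sigma>'"
  by (induction k \<Sigma> rule: swap_words.induct) auto

definition swaps :: "nat set \<Rightarrow> (nat \<times> nat) list \<Rightarrow> bool" where
  "swaps Y \<Sigma> \<longleftrightarrow> (\<forall>(i, j)\<in>set \<Sigma>. i \<in> Y \<and> j \<in> Y \<and> i \<noteq> j)"

lemma swaps_simps [simp]:
  "swaps Y []" "swaps Y ((i, j) # \<Sigma>) \<longleftrightarrow> i \<in> Y \<and> j \<in> Y \<and> i \<noteq> j \<and> swaps Y \<Sigma>"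
  "swaps Y (\<Sigma> @ \<Sigma>') \<longleftrightarrow> swaps Y \<Sigma> \<and> swaps Y \<Sigma>'" "swaps Y (rev \<Sigma>) \<longleftrightarrow> swaps Y \<Sigma>"
  by (auto simp: swaps_def)

lemma swaps_mono: "swaps Y \<Sigma> \<Longrightarrow> Y \<subseteq> Z \<Longrightarrow> swaps Z \<Sigma>"
  by (auto simp: swaps_def)

lemma hole_swap_words:
  "hole p k \<Longrightarrow> swaps ({1..n} - {k}) \<Sigma> \<Longrightarrow> hole (p @ swap_words k \<Sigma>) k"
proof (induction \<Sigma> arbitrary: p)
  case (Cons x \<Sigma>)
  obtain i j where x: "x = (i, j)" by fastforce
  then have "hole (p @ swap_word k i j) k" using Cons.prems by (intro hole_swap_word) auto
  from Cons.IH[OF this] show ?case using Cons.prems x by simp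
qed simp

lemma word_map_sws_avoid:
  "swaps Y \<Sigma> \<Longrightarrow> k \<notin> Y \<Longrightarrow> a \<noteq> k \<Longrightarrow> x \<notin> Y \<Longrightarrow> a \<noteq> x \<Longrightarrow> word_map (swap_words k \<Sigma>) a \<noteq> x"
proof (induction k \<Sigma> arbitrary: a rule: swap_words.induct)
  case (2 k i j \<Sigma>)
  have t: "word_map (swap_word k i j) a = Transposition.transpose i j a" using 2 by (intro word_map_swap_word) auto
  moreover have "Transposition.transpose i j a \<noteq> x" "Transposition.transpose i j a \<noteq> k"
    using 2 by (auto simp: transpose_def)
  ultimately show ?case using 2 by simp
qed simp

lemma swap_words_cancel:
  assumes "hole p k" "swaps ({1..n} - {k}) \<Sigma>"
  shows "p @ swap_words k \<Sigma> @ swap_words k (rev \<Sigma>) \<approx> p"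
  using assms
proof (induction \<Sigma> arbitrary: p)
  case (Cons x \<Sigma>)
  obtain i j where x: "x = (i, j)" by fastforce
  have h: "hole (p @ swap_word k i j) k" using Cons.prems x by (intro hole_swap_word) auto
  have "(p @ swap_word k i j) @ swap_words k \<Sigma> @ swap_words k (rev \<Sigma>) \<approx> p @ swap_word k i j"
    by (rule Cons.IH[OF h]) (use Cons.prems x in simp)
  from eqv_right[OF this, of "swap_word k i j"]
  have "p @ swap_words k (x # \<Sigma>) @ swap_words k (rev (x # \<Sigma>)) \<approx> p @ swap_word k i j @ swap_word k i j"
    by (simp add: x)
  also have "\<dots> \<approx> p" by (rule swap_word_swap_word) (use Cons.prems x in auto)
  finally show ?case .
qed simp

text \<open>As for products of transpositions, conjugation gathers all occurrences of
  \<open>x\<close> into at most one swap \<open>\<tau>\<close> at the front. The new list must not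
  depend on \<open>p\<close>, because the induction hypothesis is applied after the further swap
  \<open>(i, j)\<close>.\<close>

lemma swap_words_isolate:
  assumes Y: "Y \<subseteq> {1..n} - {k}" "x \<in> Y" and "swaps Y \<Sigma>"
  shows "\<exists>\<tau> \<Sigma>'. (\<tau> = [] \<or> (\<exists>a\<in>Y - {x}. \<tau> = [(x, a)])) \<and> swaps (Y - {x}) \<Sigma>' \<and>
    (\<forall>p. hole p k \<longrightarrow> p @ swap_words k \<Sigma> \<approx> p @ swap_words k (\<tau> @ \<Sigma>'))"
  using assms(3)
proof (induction \<Sigma>)
  case Nil
  show ?case by (rule exI[of _ "[]"], rule exI[of _ "[]"]) simp
next
  case (Cons y \<Sigma>)
  obtain i j where y: "y = (i, j)" by fastforce
  have ij: "i \<in> Y" "j \<in> Y" "i \<noteq> j" "swaps Y \<Sigma>" using Cons.prems y by auto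
  from Cons.IH[OF ij(4)] obtain \<tau> \<Sigma>' where \<tau>: "\<tau> = [] \<or> (\<exists>a\<in>Y - {x}. \<tau> = [(x, a)])"
    and \<Sigma>': "swaps (Y - {x}) \<Sigma>'"
    and IH: "\<And>p. hole p k \<Longrightarrow> p @ swap_words k \<Sigma> \<approx> p @ swap_words k (\<tau> @ \<Sigma>')" by blast
  have in_Y: "z \<in> {1..n}" "z \<noteq> k" if "z \<in> Y" for z using Y that by auto
  have swap_word_hole: "hole (p @ swap_word k a b) k" if "hole p k" "a \<in> Y" "b \<in> Y" "a \<noteq> b" for p a b
    by (rule hole_swap_word) (use that in_Y in auto)
  have step: "p @ swap_words k (y # \<Sigma>) \<approx> p @ swap_word k i j @ swap_words k (\<tau> @ \<Sigma>')" if "hole p k" for p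
    using IH[OF swap_word_hole[OF that ij(1-3)]] y by simp
  show ?case
  proof (cases "x \<in> {i, j}")
    case False
    show ?thesis
    proof (cases "\<tau> = []")
      case True
      show ?thesis
        by (rule exI[of _ "[]"], rule exI[of _ "(i, j) # \<Sigma>'"])
          (use \<Sigma>' ij False step True in auto)
    next
      case nonempty: False
      then obtain a where a: "a \<in> Y - {x}" "\<tau> = [(x, a)]" using \<tau> by blast
      \<comment> \<open>Chosen so that conjugating \<open>(x, a')\<close> by \<open>(i, j)\<close>
        gives \<open>(x, a)\<close>; the front swap can then be pulled before
        \<open>(i, j)\<close>.\<close>
      define a' where "a' = Transposition.transpose i j a"
      have a': "a' \<in> Y - {x}" using a ij False by (auto simp: a'_def transpose_def)
      have "p @ swap_words k (y # \<Sigma>) \<approx> p @ swap_words k ([(x, a')] @ (i, j) # \<Sigma>')" if p: "hole p k" for p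
      proof -
        have "p @ swap_word k x a' @ swap_word k i j \<approx> p @ swap_word k i j @
            swap_word k (Transposition.transpose i j x) (Transposition.transpose i j a')"
          by (rule swap_word_conj) (use p a' ij in_Y Y in auto)
        also have "Transposition.transpose i j x = x" using False by simp
        also have "Transposition.transpose i j a' = a" by (simp add: a'_def)
        finally have "p @ swap_word k i j @ swap_word k x a \<approx> p @ swap_word k x a' @ swap_word k i j" by (rule eqv_sym)
        from eqv_right[OF this, of "swap_words k \<Sigma>'"]
        have "p @ swap_word k i j @ swap_words k (\<tau> @ \<Sigma>') \<approx> p @ swap_words k ([(x, a')] @ (i, j) # \<Sigma>')"
          using a by simp
        then show ?thesis using step[OF p] eqv_trans by blast
      qed
      then show ?thesis
        by (intro exI[of _ "[(x, a')]"] exI[of _ "(i, j) # \<Sigma>'"]) (use \<Sigma>' ij a' False in auto)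
    qed
  next
    case True
    then obtain b where b: "b \<in> Y - {x}" "(i, j) = (x, b) \<or> (i, j) = (b, x)"
      using ij by auto
    have xb: "p @ swap_word k i j \<approx> p @ swap_word k x b" if "hole p k" for p
      using b swap_word_commute[OF that, of i j] ij in_Y Y by auto
    have step': "p @ swap_words k (y # \<Sigma>) \<approx> p @ swap_word k x b @ swap_words k (\<tau> @ \<Sigma>')" if "hole p k" for p
      using eqv_trans[OF step[OF that]] eqv_right[OF xb[OF that], of "swap_words k (\<tau> @ \<Sigma>')"] by simp
    show ?thesis
    proof (cases "\<tau> = []")
      case True
      show ?thesis
        by (rule exI[of _ "[(x, b)]"], rule exI[of _ "\<Sigma>'"])
          (use \<Sigma>' b step' True in auto)
    next
      case False
      then obtain a where a: "a \<in> Y - {x}" "\<tau> = [(x, a)]" using \<tau> by blast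
      show ?thesis
      proof (cases "a = b")
        case True
        have "p @ swap_words k (y # \<Sigma>) \<approx> p @ swap_words k ([] @ \<Sigma>')" if p: "hole p k" for p
        proof -
          have "p @ swap_word k x b @ swap_word k x b \<approx> p"
            by (rule swap_word_swap_word) (use p b in_Y Y in auto)
          from eqv_right[OF this, of "swap_words k \<Sigma>'"]
          have "p @ swap_word k x b @ swap_words k (\<tau> @ \<Sigma>') \<approx> p @ swap_words k ([] @ \<Sigma>')"
            using a True by simp
          then show ?thesis using step'[OF p] eqv_trans by blast
        qed
        then show ?thesis
          by (intro exI[of _ "[]"] exI[of _ "\<Sigma>'"]) (use \<Sigma>' in auto)
      next
        case False
        have "p @ swap_words k (y # \<Sigma>) \<approx> p @ swap_words k ([(x, a)] @ (a, b) # \<Sigma>')" if p: "hole p k" for p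
        proof -
          \<comment> \<open>Of two different swaps at \<open>x\<close> only one remains:
            \<open>(x, b)\<close> conjugated by \<open>(x, a)\<close> becomes \<open>(a, b)\<close>,
            which avoids \<open>x\<close>.\<close>
          have "p @ swap_word k x b @ swap_word k x a \<approx> p @ swap_word k x a @
              swap_word k (Transposition.transpose x a x) (Transposition.transpose x a b)"
            by (rule swap_word_conj) (use p a b in_Y Y in auto)
          also have "Transposition.transpose x a b = b" using False b by simp
          finally have "p @ swap_word k x b @ swap_word k x a \<approx> p @ swap_word k x a @ swap_word k a b" by simp
          from eqv_right[OF this, of "swap_words k \<Sigma>'"]
          have "p @ swap_word k x b @ swap_words k (\<tau> @ \<Sigma>') \<approx> p @ swap_words k ([(x, a)] @ (a, b) # \<Sigma>')"
            using a by simp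
          then show ?thesis using step'[OF p] eqv_trans by blast
        qed
        then show ?thesis
          by (intro exI[of _ "[(x, a)]"] exI[of _ "(a, b) # \<Sigma>'"]) (use \<Sigma>' a b False in auto)
      qed
    qed
  qed
qed

text \<open>The occupied positions in \<open>A\<close> are removed from the product one at a time.
  This uses that every token ends where it started.\<close>

lemma swap_words_eliminate:
  assumes p: "hole p k" and "swaps ({1..n} - {k}) \<Sigma>"
    and fixed: "\<And>y. y \<in> {1..n} \<Longrightarrow> word_map (p @ swap_words k \<Sigma>) y = word_map p y"
    and "finite A" "A \<subseteq> img p"
  shows "\<exists>\<Sigma>'. swaps ({1..n} - {k} - A) \<Sigma>' \<and> p @ swap_words k \<Sigma> \<approx> p @ swap_words k \<Sigma>'"
  using assms(4,5)
proof (induction A rule: finite_induct)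
  case empty
  then show ?case using assms(2) by (intro exI[of _ \<Sigma>]) simp
next
  case (insert x A)
  let ?Y = "{1..n} - {k} - A"
  obtain \<Sigma>1 where \<Sigma>1: "swaps ?Y \<Sigma>1" "p @ swap_words k \<Sigma> \<approx> p @ swap_words k \<Sigma>1"
    using insert by auto
  obtain y where y: "y \<in> {1..n}" "x = word_map p y" using insert.prems by (auto simp: img_def)
  have "k \<notin> img p" "tword p" using p by (auto simp: hole_def)
  then have x: "x \<in> ?Y" using insert img_sub by blast
  have "?Y \<subseteq> {1..n} - {k}" by blast
  from swap_words_isolate[OF this x \<Sigma>1(1)] p obtain \<tau> \<Sigma>2 where
    \<tau>: "\<tau> = [] \<or> (\<exists>a\<in>?Y - {x}. \<tau> = [(x, a)])" and \<Sigma>2: "swaps (?Y - {x}) \<Sigma>2"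
    and eq: "p @ swap_words k \<Sigma>1 \<approx> p @ swap_words k (\<tau> @ \<Sigma>2)" by blast
  have eq': "p @ swap_words k \<Sigma> \<approx> p @ swap_words k (\<tau> @ \<Sigma>2)" using \<Sigma>1(2) eq by (rule eqv_trans)
  \<comment> \<open>A front swap would take the token from \<open>x\<close> to \<open>a\<close>; the
    later swaps avoid \<open>x\<close> and never bring it back, contradicting
    \<open>fixed\<close>.\<close>
  have "\<tau> = []"
  proof (rule ccontr)
    assume "\<tau> \<noteq> []"
    then obtain a where a: "a \<in> ?Y - {x}" "\<tau> = [(x, a)]" using \<tau> by blast
    have "swaps ({1..n} - {k}) (\<tau> @ \<Sigma>2)"
      using a x swaps_mono[OF \<Sigma>2, of "{1..n} - {k}"] by auto
    then have "word_map (p @ swap_words k \<Sigma>) y = word_map (p @ swap_words k (\<tau> @ \<Sigma>2)) y"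
      using tword_sound[OF eq' _ _ y(1)] hole_swap_words[OF p] assms(2) holeD by blast
    then have "word_map (p @ swap_words k (\<tau> @ \<Sigma>2)) y = x" using fixed y by simp
    moreover have "word_map (p @ swap_words k (\<tau> @ \<Sigma>2)) y = word_map (swap_words k \<Sigma>2) (word_map (swap_word k x a) x)"
      using a y by simp
    moreover have "word_map (swap_word k x a) x = a" using a x by (subst word_map_swap_word) auto
    moreover have "word_map (swap_words k \<Sigma>2) a \<noteq> x" by (rule word_map_sws_avoid[OF \<Sigma>2]) (use a in auto)
    ultimately show False by simp
  qed
  moreover have "?Y - {x} = {1..n} - {k} - insert x A" by blast
  ultimately show ?case using \<Sigma>2 eq' by auto
qed

text \<open>Once all occupied positions are eliminated, the swaps left over involve empty positions
  only, and each of their three slides is trivial.\<close>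

lemma swap_words_trivial:
  assumes p: "hole p k" and "swaps ({1..n} - {k}) \<Sigma>"
    and "\<And>y. y \<in> {1..n} \<Longrightarrow> word_map (p @ swap_words k \<Sigma>) y = word_map p y"
  shows "p @ swap_words k \<Sigma> \<approx> p"
proof -
  have "finite (img p)" by (simp add: img_def)
  from swap_words_eliminate[OF assms this order.refl] obtain \<Sigma>' where
    \<Sigma>': "swaps ({1..n} - {k} - img p) \<Sigma>'" and eq: "p @ swap_words k \<Sigma> \<approx> p @ swap_words k \<Sigma>'" by blast
  have "p @ swap_words k \<Sigma>' \<approx> p" using \<Sigma>'
  proof (induction \<Sigma>')
    case (Cons y \<Sigma>')
    obtain i j where y: "y = (i, j)" by fastforce
    have h: "hole p i" "hole p j" "k \<in> {1..n}" "i \<noteq> k" "j \<noteq> k" "i \<noteq> j"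
      using Cons.prems y p by (auto simp: hole_def)
    have "p @ swap_word k i j \<approx> p @ [T i j, T j k]"
      using eqv_right[OF hole_noop[OF h(1), of k], of "[T i j, T j k]"] h by (simp add: swap_word_def)
    also have "\<dots> \<approx> p @ [T j k]"
      using eqv_right[OF hole_noop[OF h(2), of i], of "[T j k]"] h holeD(2)[OF h(1)] by simp
    also have "\<dots> \<approx> p" using hole_noop[OF p, of j] h holeD(2)[OF h(2)] by simp
    finally have "p @ swap_words k (y # \<Sigma>') \<approx> p @ swap_words k \<Sigma>'"
      using eqv_right[of "p @ swap_word k i j" p "swap_words k \<Sigma>'"] y by simp
    then show ?case using Cons y eqv_trans by auto
  qed simp
  then show ?thesis using eq eqv_trans by blast
qed

text \<open>The product of \<open>\<Sigma>\<close> and the reverse of \<open>\<Sigma>'\<close> fixes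
  all tokens and is therefore trivial; appending \<open>\<Sigma>'\<close> then cancels that
  reverse.\<close>

lemma swap_words_unique:
  assumes p: "hole p k" and \<Sigma>: "swaps ({1..n} - {k}) \<Sigma>" and \<Sigma>': "swaps ({1..n} - {k}) \<Sigma>'"
    and eq: "\<And>y. y \<in> {1..n} \<Longrightarrow> word_map (p @ swap_words k \<Sigma>) y = word_map (p @ swap_words k \<Sigma>') y"
  shows "p @ swap_words k \<Sigma> \<approx> p @ swap_words k \<Sigma>'"
proof -
  have rev: "rev (rev \<Sigma>') = \<Sigma>'" by simp
  have "word_map (p @ swap_words k (\<Sigma> @ rev \<Sigma>')) y = word_map p y" if y: "y \<in> {1..n}" for y
  proof -
    have "word_map (p @ swap_words k (\<Sigma> @ rev \<Sigma>')) y = word_map (p @ swap_words k \<Sigma>' @ swap_words k (rev \<Sigma>')) y"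
      using eq[OF y] by simp
    also have "\<dots> = word_map p y"
      using tword_sound[OF swap_words_cancel[OF p \<Sigma>'] _ _ y] hole_swap_words[OF p, of "\<Sigma>' @ rev \<Sigma>'"] \<Sigma>' p
        holeD(1) by fastforce
    finally show ?thesis .
  qed
  then have "p @ swap_words k (\<Sigma> @ rev \<Sigma>') \<approx> p" using \<Sigma> \<Sigma>' by (intro swap_words_trivial[OF p]) auto
  from eqv_sym[OF eqv_right[OF this, of "swap_words k \<Sigma>'"]]
  have "p @ swap_words k \<Sigma>' \<approx> p @ swap_words k \<Sigma> @ swap_words k (rev \<Sigma>') @ swap_words k \<Sigma>'" by simp
  also have "\<dots> \<approx> p @ swap_words k \<Sigma>"
    using swap_words_cancel[OF hole_swap_words[OF p \<Sigma>], of "rev \<Sigma>'"] \<Sigma>' by simp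
  finally show ?thesis by (rule eqv_sym)
qed

text \<open>A move of the marked empty position \<open>k\<close> to \<open>l\<close>.\<close>

definition tail :: "nat \<Rightarrow> nat \<Rightarrow> letter list" where
  "tail k l = (if l = k then [] else [T k l])"

lemma tail_simps [simp]: "tail k k = []" "l \<noteq> k \<Longrightarrow> tail k l = [T k l]"
  by (simp_all add: tail_def)

text \<open>In the main case the empty position travels from \<open>k\<close> over \<open>l\<close>
  to \<open>m\<close>. Adding a round trip from \<open>m\<close> to \<open>k\<close> completes this
  to the swap of \<open>l\<close> and \<open>m\<close> followed by \<open>T k m\<close>.\<close>

lemma tail_step:
  assumes p: "hole p k" and \<Sigma>: "swaps ({1..n} - {k}) \<Sigma>"
    and lm: "l \<in> {1..n}" "m \<in> {1..n}" "l \<noteq> m"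
  shows "\<exists>\<Sigma>'. swaps ({1..n} - {k}) \<Sigma>' \<and> p @ swap_words k \<Sigma> @ tail k l @ [T l m] \<approx> p @ swap_words k \<Sigma>' @ tail k m"
proof -
  have k: "k \<in> {1..n}" using p holeD by blast
  have q: "hole (p @ swap_words k \<Sigma>) k" using p \<Sigma> by (rule hole_swap_words)
  consider "l = k" | "l \<noteq> k" "m = k" | "l \<noteq> k" "m \<noteq> k" by blast
  then show ?thesis
  proof cases
    case 1
    then show ?thesis using \<Sigma> lm by (intro exI[of _ \<Sigma>]) simp
  next
    case 2
    then show ?thesis using \<Sigma> slide_back[OF q lm(1)] by (intro exI[of _ \<Sigma>]) simp
  next
    case 3
    let ?q = "p @ swap_words k \<Sigma> @ [T k l, T l m]"
    have h: "hole ?q m"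
      using hole_slide[OF hole_slide[OF q lm(1)], of m] 3 lm by simp
    have "?q \<approx> ?q @ [T m k, T k m]"
      using slide_back[OF h k] 3 by (auto intro: eqv_sym)
    then have "?q \<approx> p @ swap_words k (\<Sigma> @ [(l, m)]) @ tail k m" using 3 by (simp add: swap_word_def)
    then show ?thesis using \<Sigma> lm 3 by (intro exI[of _ "\<Sigma> @ [(l, m)]"]) simp
  qed
qed

text \<open>After \<open>q\<close> the position \<open>m\<close> is also empty, so the trivial
  letter \<open>T l m\<close> may be appended and absorbed by \<open>tail_step\<close>. The mark
  thus passes to any other empty position.\<close>

lemma tail_move:
  assumes p: "hole p k" and \<Sigma>: "swaps ({1..n} - {k}) \<Sigma>"
    and q: "hole q l" "hole q m" and eq: "q \<approx> p @ swap_words k \<Sigma> @ tail k l"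
  shows "\<exists>\<Sigma>'. swaps ({1..n} - {k}) \<Sigma>' \<and> q \<approx> p @ swap_words k \<Sigma>' @ tail k m"
proof (cases "l = m")
  case True
  then show ?thesis using \<Sigma> eq by blast
next
  case False
  have lm: "l \<in> {1..n}" "m \<in> {1..n}" using q holeD by auto
  have "q \<approx> q @ [T l m]" using hole_noop[OF q(2) lm(1) False] by (rule eqv_sym)
  also have "\<dots> \<approx> p @ swap_words k \<Sigma> @ tail k l @ [T l m]" using eqv_right[OF eq, of "[T l m]"] by simp
  finally show ?thesis using tail_step[OF p \<Sigma> lm False] eqv_trans by blast
qed

text \<open>By injectivity no letter of \<open>u\<close> merges two tokens. Each letter either
  starts from an empty position and is trivial, or fills an empty one, to which the mark is first
  transferred.\<close>

lemma slide_normal_form: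
  assumes p: "hole p k" and "tword u" "inj_on (word_map u) (img p)"
  shows "\<exists>\<Sigma> l. swaps ({1..n} - {k}) \<Sigma> \<and> hole (p @ u) l \<and> p @ u \<approx> p @ swap_words k \<Sigma> @ tail k l"
  using assms(2,3)
proof (induction u rule: rev_induct)
  case Nil
  show ?case by (rule exI[of _ "[]"], rule exI[of _ k]) (use p in simp)
next
  case (snoc a u)
  obtain i j where a: "a = T i j" and ij: "i \<in> {1..n}" "j \<in> {1..n}" "i \<noteq> j"
    using snoc.prems(1) by auto
  have inj: "inj_on (act a \<circ> word_map u) (img p)"
    using snoc.prems(2) by (simp add: comp_def)
  then obtain \<Sigma> l where IH: "swaps ({1..n} - {k}) \<Sigma>" "hole (p @ u) l" "p @ u \<approx> p @ swap_words k \<Sigma> @ tail k l"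
    using snoc.IH[OF _ inj_on_imageI2[OF inj]] snoc.prems(1) by auto
  have img: "img (p @ u) = word_map u ` img p" by (auto simp: img_def)
  have tu: "tword (p @ u)" using snoc.prems p holeD by auto
  show ?case
  proof (cases "j \<in> img (p @ u)")
    case False
    have "(p @ u) @ [T i j] \<approx> p @ u" by (rule noop[OF tu]) (use ij False in auto)
    also note IH(3)
    finally have "p @ u @ [a] \<approx> p @ swap_words k \<Sigma> @ tail k l" using a by simp
    moreover have "img ((p @ u) @ [a]) = img (p @ u)"
      unfolding img_snoc a using False by (force simp: image_iff)
    then have "hole (p @ u @ [a]) l"
      using IH(2) snoc.prems(1) by (simp add: hole_def)
    ultimately show ?thesis using IH(1) by blast
  next
    case True
    \<comment> \<open>Otherwise \<open>T i j\<close> would merge the tokens at \<open>i\<close> and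
      \<open>j\<close>.\<close>
    have "i \<notin> img (p @ u)"
    proof
      assume "i \<in> img (p @ u)"
      then obtain x y where xy: "x \<in> img p" "y \<in> img p" "i = word_map u x" "j = word_map u y"
        using True img by auto
      then have "(act a \<circ> word_map u) x = (act a \<circ> word_map u) y" by (simp add: a)
      then have "x = y" using inj_onD[OF inj, of x y] xy by simp
      then show False using xy ij by simp
    qed
    then have hi: "hole (p @ u) i" using tu ij by (simp add: hole_def)
    then obtain \<Sigma>1 where \<Sigma>1: "swaps ({1..n} - {k}) \<Sigma>1" "p @ u \<approx> p @ swap_words k \<Sigma>1 @ tail k i"
      using tail_move[OF p IH(1,2) _ IH(3)] by blast
    obtain \<Sigma>2 where \<Sigma>2: "swaps ({1..n} - {k}) \<Sigma>2"
      "p @ swap_words k \<Sigma>1 @ tail k i @ [T i j] \<approx> p @ swap_words k \<Sigma>2 @ tail k j"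
      using tail_step[OF p \<Sigma>1(1) ij] by blast
    have "p @ u @ [a] \<approx> p @ swap_words k \<Sigma>1 @ tail k i @ [T i j]"
      using eqv_right[OF \<Sigma>1(2), of "[a]"] a by simp
    also note \<Sigma>2(2)
    finally have "p @ u @ [a] \<approx> p @ swap_words k \<Sigma>2 @ tail k j" .
    moreover have "hole (p @ u @ [a]) j" using hole_slide[OF hi, of j] ij a by simp
    ultimately show ?thesis using \<Sigma>2(1) by blast
  qed
qed

subsection \<open>Completeness of the relations\<close>

text \<open>The two points of the edge are moved by the map of \<open>T i j\<close>, and the edge
  disappears when they become equal.\<close>

lemma E_slide:
  assumes "i \<in> {1..n}" "j \<in> {1..n}" "i \<noteq> j" "k \<in> {1..n}" "l \<in> {1..n}" "k \<noteq> l"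
  shows "[E k l, T i j] \<approx>
    [T i j] @ (if act (T i j) k = act (T i j) l then [] else [E (act (T i j) k) (act (T i j) l)])"
proof -
  have j: "[E j m, T i j] \<approx> [T i j, E i m]" if "m \<in> {1..n}" "m \<noteq> i" "m \<noteq> j" for m
    by (rule eqv_rel[OF et2]) (use assms that in auto)
  \<comment> \<open>The relation \<open>et2\<close> covers edges at \<open>j\<close> only. An edge
    at \<open>i\<close> is traded for one at \<open>j\<close> by \<open>ee2\<close>, using the edge
    \<open>E i j\<close> that \<open>T i j\<close> absorbs by \<open>et1\<close>.\<close>
  have i: "[E i m, T i j] \<approx> [T i j, E i m]" if m: "m \<in> {1..n}" "m \<noteq> i" "m \<noteq> j" for m
  proof -
    have "[E i m, T i j] \<approx> [E m i, E i j, T i j]"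
      using eqv_left[OF eqv_sym[OF eqv_rel[OF et1[of i j]]], of "[E i m]"] assms
      by (simp add: insert_commute)
    also have "\<dots> \<approx> [E i j, E j m, T i j]"
      using eqv_right[OF eqv_rel[OF ee2[of m i j]], of "[T i j]"] assms m by simp
    also have "\<dots> \<approx> [E i j, T i j, E i m]"
      using eqv_left[OF j[OF m], of "[E i j]"] by simp
    also have "\<dots> \<approx> [T i j, E i m]"
      using eqv_right[OF eqv_rel[OF et1[of i j]], of "[E i m]"] assms by simp
    finally show ?thesis .
  qed
  consider "{k, l} = {i, j}" | "k = j" "l \<noteq> i" | "l = j" "k \<noteq> i" | "k = i" "l \<noteq> j" | "l = i" "k \<noteq> j"
    | "k \<noteq> i" "k \<noteq> j" "l \<noteq> i" "l \<noteq> j" by blast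
  then show ?thesis
  proof cases
    case 1
    then show ?thesis using eqv_rel[OF et1[of i j]] assms by (auto simp: doubleton_eq_iff insert_commute)
  next
    case 2
    then show ?thesis using j[of l] assms by auto
  next
    case 3
    then show ?thesis using j[of k] assms by (auto simp: insert_commute)
  next
    case 4
    then show ?thesis using i[of l] assms by auto
  next
    case 5
    then show ?thesis using i[of k] assms by (auto simp: insert_commute)
  next
    case 6
    then show ?thesis using eqv_rel[OF et3[of i j k l]] assms by auto
  qed
qed

text \<open>Slid through \<open>u\<close>, the edge has to vanish at some letter, because its end
  points finally coincide.\<close>

lemma E_absorb:
  "tword u \<Longrightarrow> k \<in> {1..n} \<Longrightarrow> l \<in> {1..n} \<Longrightarrow> k \<noteq> l \<Longrightarrow> word_map u k = word_map u l \<Longrightarrow> E k l # u \<approx> u"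
proof (induction u arbitrary: k l)
  case (Cons a u)
  obtain i j where a: "a = T i j" and ij: "i \<in> {1..n}" "j \<in> {1..n}" "i \<noteq> j"
    using Cons.prems(1) by auto
  have "E k l # a # u \<approx> T i j #
      (if act (T i j) k = act (T i j) l then [] else [E (act (T i j) k) (act (T i j) l)]) @ u"
    using eqv_right[OF E_slide[OF ij Cons.prems(2-4)], of u] a by (simp del: act.simps)
  also have "\<dots> \<approx> a # u"
  proof (cases "act a k = act a l")
    case True
    then show ?thesis using a by simp
  next
    case False
    have "E (act a k) (act a l) # u \<approx> u"
      by (rule Cons.IH) (use Cons.prems a ij False in auto)
    from eqv_left[OF this, of "[a]"] show ?thesis using False a by simp
  qed
  finally show ?case .
qed simp

text \<open>The word \<open>u\<close> supplies the letter \<open>E k l\<close>, which absorbs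
  \<open>T k l\<close> by \<open>et4\<close> and returns to \<open>u\<close>.\<close>

lemma T_absorb:
  assumes "tword u" "k \<in> {1..n}" "l \<in> {1..n}" "k \<noteq> l" "word_map u k = word_map u l"
  shows "T k l # u \<approx> u"
proof -
  have u: "E k l # u \<approx> u" using assms by (rule E_absorb)
  have "T k l # u \<approx> T k l # E k l # u" using eqv_left[OF eqv_sym[OF u], of "[T k l]"] by simp
  also have "\<dots> \<approx> E k l # u" using eqv_right[OF eqv_rel[OF et4[of k l]], of u] assms by simp
  also note u
  finally show ?thesis .
qed

lemma E_push:
  "tword t \<Longrightarrow> k \<in> {1..n} \<Longrightarrow> l \<in> {1..n} \<Longrightarrow> k \<noteq> l \<Longrightarrow> \<exists>e. eword e \<and> E k l # t \<approx> t @ e"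
proof (induction t arbitrary: k l)
  case Nil
  then show ?case by (intro exI[of _ "[E k l]"]) auto
next
  case (Cons a t)
  obtain i j where a: "a = T i j" and ij: "i \<in> {1..n}" "j \<in> {1..n}" "i \<noteq> j"
    using Cons.prems(1) by auto
  have step: "E k l # a # t \<approx> a #
      (if act a k = act a l then [] else [E (act a k) (act a l)]) @ t"
    using eqv_right[OF E_slide[OF ij Cons.prems(2-4)], of t] a by (auto simp del: act.simps split: if_splits)
  show ?case
  proof (cases "act a k = act a l")
    case True
    then show ?thesis using step by (intro exI[of _ "[]"]) simp
  next
    case False
    have "act a k \<in> {1..n}" "act a l \<in> {1..n}" using Cons.prems a ij by auto
    with Cons.IH[OF _ this False] obtain e where
      e: "eword e" "E (act a k) (act a l) # t \<approx> t @ e" using Cons.prems by auto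
    from step have "E k l # a # t \<approx> [a] @ E (act a k) (act a l) # t" using False by simp
    also have "\<dots> \<approx> [a] @ t @ e" using e(2) by (rule eqv_left)
    finally show ?thesis using e(1) by (intro exI[of _ e]) simp
  qed
qed

lemma word_split:
  "w \<in> lists (alphabet n) \<Longrightarrow> \<exists>t e. tword t \<and> eword e \<and> w \<approx> t @ e"
proof (induction w)
  case Nil
  show ?case by (rule exI[of _ "[]"], rule exI[of _ "[]"]) simp
next
  case (Cons a w)
  then obtain t e where te: "tword t" "eword e" "w \<approx> t @ e" by auto
  have aw: "a # w \<approx> a # t @ e" using eqv_left[OF te(3), of "[a]"] by simp
  have "a \<in> alphabet n" using Cons.prems by simp
  then consider i j where "a = E i j" "i \<in> {1..n}" "j \<in> {1..n}" "i \<noteq> j"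
    | i j where "a = T i j" "i \<in> {1..n}" "j \<in> {1..n}" "i \<noteq> j"
    unfolding alphabet_eq by blast
  then show ?case
  proof cases
    case (1 i j)
    obtain e' where "eword e'" "a # t \<approx> t @ e'" using E_push[OF te(1) 1(2-4)] 1(1) by auto
    then show ?thesis using te aw eqv_right[of "a # t" "t @ e'" e]
      by (intro exI[of _ t] exI[of _ "e' @ e"]) (auto intro: eqv_trans)
  next
    case (2 i j)
    then show ?thesis using te aw by (intro exI[of _ "a # t"] exI[of _ e]) auto
  qed
qed

section \<open>Words in the commuting letters \<open>E i j\<close>\<close>

lemma E_commute:
  assumes "eword e" "i \<in> {1..n}" "j \<in> {1..n}" "i \<noteq> j"
  shows "e @ [E i j] \<approx> E i j # e"
  using assms(1)
proof (induction e)
  case (Cons a e)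
  then obtain k l where a: "a = E k l" "k \<in> {1..n}" "l \<in> {1..n}" "k \<noteq> l" by auto
  have "a # e @ [E i j] \<approx> [a] @ E i j # e"
    using eqv_left[of _ _ "[a]"] Cons by fastforce
  also have "\<dots> \<approx> E i j # a # e"
    using eqv_right[OF eqv_rel[OF ee_comm[of k l i j]], of e] a assms by simp
  finally show ?case by simp
qed simp

lemma eword_commute: "eword e \<Longrightarrow> eword e' \<Longrightarrow> e @ e' \<approx> e' @ e"
proof (induction e')
  case (Cons a e')
  then obtain i j where a: "a = E i j" "i \<in> {1..n}" "j \<in> {1..n}" "i \<noteq> j" by auto
  have "e @ a # e' \<approx> a # e @ e'"
    using eqv_right[OF E_commute[OF Cons.prems(1) a(2-4)], of e'] a by simp
  also have "\<dots> \<approx> a # e' @ e" using eqv_left[of _ _ "[a]"] Cons by fastforce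
  finally show ?case by simp
qed simp

lemma word_map_eword: "eword e \<Longrightarrow> word_map e = id"
  by (induction e) auto

lemma word_pairs_eword: "eword e \<Longrightarrow> (x, y) \<in> word_pairs e \<longleftrightarrow> (\<exists>A. EdgeLetter A \<in> set e \<and> x \<in> A \<and> y \<in> A)"
proof (induction e)
  case (Cons a e)
  then have "word_pairs (a # e) = letter_pairs a \<union> word_pairs e" by (simp add: word_map_eword map_prod.id)
  moreover obtain i j where "a = E i j" using Cons.prems by auto
  moreover have "(x, y) \<in> word_pairs e \<longleftrightarrow> (\<exists>A. EdgeLetter A \<in> set e \<and> x \<in> A \<and> y \<in> A)"
    by (rule Cons.IH) (use Cons.prems in simp)
  ultimately show ?case by (simp only: Un_iff letter_pairs.simps mem_Times_iff fst_conv snd_conv list.set insert_iff letter.inject) blast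
qed simp

text \<open>Induction over the generated equivalence: edges that occur in \<open>e\<close> are
  absorbed by commutation and idempotence, and transitivity corresponds to the triangle relation
  \<open>ee2\<close>.\<close>

lemma eword_absorb_equiv_cl:
  assumes e: "eword e" and "(x, y) \<in> equiv_cl n (word_pairs e)"
  shows "x = y \<or> e @ [E x y] \<approx> e"
  using assms(2)
proof induction
  case (equiv_cl_base x y)
  then obtain A where A: "EdgeLetter A \<in> set e" "x \<in> A" "y \<in> A" using word_pairs_eword[OF e] by blast
  moreover obtain i j where "EdgeLetter A = E i j" using A e by (auto simp: eword_def)
  ultimately have xy: "x = y \<or> EdgeLetter A = E x y" by auto
  show ?case
  proof (cases "x = y")
    case False
    then have in_e: "E x y \<in> set e" using xy A by simp
    then obtain u v where uv: "e = u @ E x y # v" by (auto dest: split_list)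
    have n: "x \<in> {1..n}" "y \<in> {1..n}"
      using e in_e False by (auto simp: eword_def doubleton_eq_iff)
    have "e @ [E x y] \<approx> u @ [E x y, E x y] @ v"
      using eqv_left[OF E_commute[of v x y], of "u @ [E x y]"] e n False uv by simp
    also have "\<dots> \<approx> e" using eqv_ctx[OF eqv_rel[OF ee1[of x y]], of u v] n False uv by simp
    finally show ?thesis by simp
  qed simp
next
  case (equiv_cl_trans x y z)
  show ?case
  proof (cases "x = y \<or> y = z \<or> x = z")
    case False
    have n: "x \<in> {1..n}" "y \<in> {1..n}" "z \<in> {1..n}"
      using equiv_equiv_cl[OF word_pairs_sub[OF eword_lists[OF e]]] equiv_cl_trans.hyps unfolding equiv_def by auto
    have xyz: "e @ [E x y, E y z] \<approx> e"
      using eqv_trans[OF eqv_right[of "e @ [E x y]" e "[E y z]"]] equiv_cl_trans.IH False by simp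
    have "e @ [E x z] \<approx> e @ [E x y, E y z] @ [E z x]"
      using eqv_right[OF eqv_sym[OF xyz], of "[E x z]"] by (simp add: insert_commute)
    also have "\<dots> \<approx> e @ [E y z, E z x] @ [E z x]"
      using eqv_ctx[OF eqv_rel[OF ee2[of x y z]], of e "[E z x]"] n False by simp
    also have "\<dots> \<approx> e @ [E y z, E z x]"
      using eqv_left[OF eqv_rel[OF ee1[of z x]], of "e @ [E y z]"] n False by simp
    also have "\<dots> \<approx> e @ [E x y, E y z]"
      using eqv_left[OF eqv_sym[OF eqv_rel[OF ee2[of x y z]]], of e] n False by simp
    also note xyz
    finally show ?thesis by simp
  qed (use equiv_cl_trans in auto)
qed (auto simp: insert_commute)

lemma eword_absorb:
  assumes "eword e" "eword e'" "word_pairs e' \<subseteq> equiv_cl n (word_pairs e)"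
  shows "e @ e' \<approx> e"
  using assms(2,3)
proof (induction e')
  case (Cons a e')
  obtain i j where a: "a = E i j" "i \<noteq> j" using Cons.prems by auto
  then have "(i, j) \<in> equiv_cl n (word_pairs e)" using Cons.prems word_map_eword[of e'] by auto
  then have "e @ [a] \<approx> e" using eword_absorb_equiv_cl[OF assms(1)] a by blast
  from eqv_right[OF this, of e'] have "e @ a # e' \<approx> e @ e'" by simp
  also have "\<dots> \<approx> e" by (rule Cons.IH) (use Cons.prems in auto)
  finally show ?case .
qed simp

text \<open>Each word absorbs the other and they commute, so both are equivalent to their
  product.\<close>

lemma eword_complete:
  assumes "eword e" "eword e'" "equiv_cl n (word_pairs e) = equiv_cl n (word_pairs e')"
  shows "e \<approx> e'"
proof -
  have "e @ e' \<approx> e" "e' @ e \<approx> e'"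
    by (rule eword_absorb; use assms in \<open>auto intro: equiv_cl_base\<close>)+
  then show ?thesis using eword_commute[OF assms(1,2)] eqv_sym eqv_trans by blast
qed

text \<open>The word \<open>e\<close> produces the edge \<open>E i j\<close>, which swallows
  \<open>T i j\<close> by \<open>et4\<close>. This permits changing a map within the classes of the
  equivalence.\<close>

lemma T_absorb_eword:
  assumes e: "eword e" and "(i, j) \<in> equiv_cl n (word_pairs e)" "i \<noteq> j"
  shows "T i j # e \<approx> e"
proof -
  have n: "i \<in> {1..n}" "j \<in> {1..n}"
    using equiv_equiv_cl[OF word_pairs_sub[OF eword_lists[OF e]]] assms(2) unfolding equiv_def by auto
  have E: "E i j # e \<approx> e"
    using eqv_trans[OF eqv_sym[OF E_commute[OF e n assms(3)]]] eword_absorb_equiv_cl[OF assms(1,2)] assms(3)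
    by blast
  have "T i j # e \<approx> T i j # E i j # e" using eqv_left[OF eqv_sym[OF E], of "[T i j]"] by simp
  also have "\<dots> \<approx> E i j # e" using eqv_right[OF eqv_rel[OF et4[of i j]], of e] n assms(3) by simp
  also note E
  finally show ?thesis .
qed

section \<open>Idempotent words with prescribed kernel\<close>

definition rep :: "(nat \<Rightarrow> 'a) \<Rightarrow> nat \<Rightarrow> nat" where
  "rep c x = (LEAST y. y \<in> {1..n} \<and> c y = c x)"

text \<open>The labelling \<open>c\<close> will be a map on \<open>{1..n}\<close>, whose kernel is
  wanted, or the map sending a point to its equivalence class.\<close>

definition rep_word :: "(nat \<Rightarrow> 'a) \<Rightarrow> letter list" where
  "rep_word c = map (\<lambda>x. T (rep c x) x) (filter (\<lambda>x. rep c x \<noteq> x) [1..<Suc n])"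

lemma rep_in: "x \<in> {1..n} \<Longrightarrow> rep c x \<in> {1..n}" "x \<in> {1..n} \<Longrightarrow> c (rep c x) = c x"
  using LeastI[of "\<lambda>y. y \<in> {1..n} \<and> c y = c x" x] by (auto simp: rep_def)

lemma rep_eq_iff: "x \<in> {1..n} \<Longrightarrow> y \<in> {1..n} \<Longrightarrow> rep c x = rep c y \<longleftrightarrow> c x = c y"
proof
  assume "x \<in> {1..n}" "y \<in> {1..n}" "rep c x = rep c y"
  then show "c x = c y" using rep_in(2)[of x c] rep_in(2)[of y c] by simp
qed (simp add: rep_def)

lemma rep_rep: "x \<in> {1..n} \<Longrightarrow> rep c (rep c x) = rep c x"
  using rep_eq_iff[of "rep c x" x c] rep_in[of x c] by simp

text \<open>The point found here is left empty by \<open>rep_word c\<close>, so a collision of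
  labels provides the empty position required for swaps.\<close>

lemma rep_moves:
  "i \<in> {1..n} \<Longrightarrow> j \<in> {1..n} \<Longrightarrow> i \<noteq> j \<Longrightarrow> c i = c j \<Longrightarrow> \<exists>x\<in>{1..n}. rep c x \<noteq> x"
  using rep_eq_iff by metis

lemma tword_rep_word: "tword (rep_word c)"
  using rep_in(1) by (auto simp: tword_def rep_word_def atLeastLessThanSuc_atLeastAtMost simp del: upt_Suc)

lemma word_map_rep_word:
  assumes "x \<in> {1..n}"
  shows "word_map (rep_word c) x = rep c x"
proof -
  \<comment> \<open>The condition says that no representative is moved by a letter of the list, so
    the letters do not interfere with each other.\<close>
  have "word_map (map (\<lambda>x. T (rep c x) x) xs) y = (if y \<in> set xs then rep c y else y)"
    if "\<forall>x\<in>set xs. rep c x \<notin> set xs" for xs y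
    using that
  proof (induction xs arbitrary: y)
    case (Cons x xs)
    then show ?case by auto
  qed simp
  from this[of "filter (\<lambda>x. rep c x \<noteq> x) [1..<Suc n]" x] show ?thesis
    using assms rep_rep[of _ c] unfolding rep_word_def
    by (auto simp: atLeastLessThanSuc_atLeastAtMost simp del: upt_Suc)
qed

lemma hole_rep_word: "x \<in> {1..n} \<Longrightarrow> rep c x \<noteq> x \<Longrightarrow> hole (rep_word c) x"
  using rep_rep[of _ c] tword_rep_word by (auto simp: hole_def img_def word_map_rep_word)

lemma rep_word_absorb:
  assumes "\<And>x. x \<in> {1..n} \<Longrightarrow> rep c x \<noteq> x \<Longrightarrow> T (rep c x) x # w \<approx> w"
  shows "rep_word c @ w \<approx> w"
proof -
  have "map (\<lambda>x. T (rep c x) x) xs @ w \<approx> w"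
    if "\<forall>x\<in>set xs. x \<in> {1..n} \<and> rep c x \<noteq> x" for xs
    using that
  proof (induction xs)
    case (Cons x xs)
    then have "map (\<lambda>x. T (rep c x) x) (x # xs) @ w \<approx> T (rep c x) x # w"
      using eqv_left[of _ _ "[T (rep c x) x]"] by fastforce
    also have "\<dots> \<approx> w" using assms Cons.prems by simp
    finally show ?case .
  qed simp
  then show ?thesis unfolding rep_word_def
    by (simp add: atLeastLessThanSuc_atLeastAtMost del: upt_Suc)
qed

lemma hole_cong:
  "tword u \<Longrightarrow> hole v l \<Longrightarrow> (\<And>x. x \<in> {1..n} \<Longrightarrow> word_map u x = word_map v x) \<Longrightarrow> hole u l"
  by (auto simp: hole_def img_def)

text \<open>The first letter of \<open>u\<close> identifies two points, so the idempotent word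
  \<open>?p\<close> with the kernel of \<open>u\<close> leaves some \<open>k\<close> empty. Both
  words absorb \<open>?p\<close>, are injective on its image, and can be compared in normal
  form.\<close>

lemma tword_complete:
  assumes u: "tword u" "u \<noteq> []" and v: "tword v" and eq: "\<And>x. x \<in> {1..n} \<Longrightarrow> word_map u x = word_map v x"
  shows "u \<approx> v"
proof -
  let ?p = "rep_word (word_map u)"
  obtain i j u' where "u = T i j # u'" "i \<in> {1..n}" "j \<in> {1..n}" "i \<noteq> j"
    using u by (cases u) auto
  then obtain k where "k \<in> {1..n}" "rep (word_map u) k \<noteq> k" using rep_moves[of i j "word_map u"] by auto
  then have p: "hole ?p k" by (rule hole_rep_word)
  have absorb: "?p @ w \<approx> w" if w: "tword w" "\<And>x. x \<in> {1..n} \<Longrightarrow> word_map w x = word_map u x" for w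
  proof (rule rep_word_absorb)
    fix x assume x: "x \<in> {1..n}" "rep (word_map u) x \<noteq> x"
    then show "T (rep (word_map u) x) x # w \<approx> w"
      using rep_in[of x "word_map u"] by (intro T_absorb[OF w(1)]) (auto simp: w(2))
  qed
  have inj: "inj_on (word_map w) (img ?p)" if "\<And>x. x \<in> {1..n} \<Longrightarrow> word_map w x = word_map u x" for w
    using that rep_in[of _ "word_map u"] rep_eq_iff[of _ _ "word_map u"]
    by (auto simp: img_def word_map_rep_word inj_on_def)
  obtain \<Sigma> l where \<Sigma>: "swaps ({1..n} - {k}) \<Sigma>" "hole (?p @ u) l"
    "?p @ u \<approx> ?p @ swap_words k \<Sigma> @ tail k l"
    using slide_normal_form[OF p u(1) inj] by blast
  obtain \<Sigma>' l' where \<Sigma>': "swaps ({1..n} - {k}) \<Sigma>'" "hole (?p @ v) l'"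
    "?p @ v \<approx> ?p @ swap_words k \<Sigma>' @ tail k l'"
    using slide_normal_form[OF p v inj] eq by metis
  have word_map_eq: "word_map (?p @ v) x = word_map (?p @ u) x" if "x \<in> {1..n}" for x
    using eq[OF word_map_in[OF tword_rep_word[of "word_map u"] that]] by simp
  \<comment> \<open>The empty positions after a word depend only on its map, so both normal forms
    can be given the same final position \<open>l\<close>.\<close>
  have "hole (?p @ v) l"
    by (rule hole_cong[OF _ \<Sigma>(2)]) (use word_map_eq v tword_rep_word in auto)
  then obtain \<Sigma>2 where \<Sigma>2: "swaps ({1..n} - {k}) \<Sigma>2" "?p @ v \<approx> ?p @ swap_words k \<Sigma>2 @ tail k l"
    using tail_move[OF p \<Sigma>'(1,2) _ \<Sigma>'(3)] by blast
  have n: "k \<in> {1..n}" "l \<in> {1..n}" using p \<Sigma>(2) holeD by auto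
  \<comment> \<open>Returning the empty position from \<open>l\<close> to \<open>k\<close> isolates
    the product of swaps; hence the two products have the same map.\<close>
  have untail: "word_map (?p @ swap_words k \<Sigma>) x = word_map (tail l k) (word_map (?p @ w) x)"
    if "swaps ({1..n} - {k}) \<Sigma>" "?p @ w \<approx> ?p @ swap_words k \<Sigma> @ tail k l" "tword w" "x \<in> {1..n}"
    for \<Sigma> w x
  proof -
    have h: "hole (?p @ swap_words k \<Sigma>) k" using p that(1) by (rule hole_swap_words)
    have "(?p @ w) @ tail l k \<approx> ?p @ swap_words k \<Sigma> @ tail k l @ tail l k"
      using eqv_right[OF that(2), of "tail l k"] by simp
    also have "\<dots> \<approx> ?p @ swap_words k \<Sigma>"
      using slide_back[OF h n(2)] by (cases "l = k") auto
    finally show ?thesis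
      using tword_sound[OF _ _ _ that(4)] that(3) tword_rep_word holeD(1)[OF h] n
      by (cases "l = k") force+
  qed
  have "?p @ swap_words k \<Sigma> \<approx> ?p @ swap_words k \<Sigma>2"
    by (rule swap_words_unique[OF p \<Sigma>(1) \<Sigma>2(1)])
      (simp only: untail[OF \<Sigma>(1,3) u(1)] untail[OF \<Sigma>2 v] word_map_eq)
  then have \<Sigma>_eq: "(?p @ swap_words k \<Sigma>) @ tail k l \<approx> (?p @ swap_words k \<Sigma>2) @ tail k l" by (rule eqv_right)
  have "u \<approx> ?p @ u" by (rule eqv_sym[OF absorb[OF u(1) refl]])
  also note \<Sigma>(3)
  also have "?p @ swap_words k \<Sigma> @ tail k l \<approx> ?p @ swap_words k \<Sigma>2 @ tail k l" using \<Sigma>_eq by simp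
  also have "\<dots> \<approx> ?p @ v" using \<Sigma>2(2) by (rule eqv_sym)
  also have "\<dots> \<approx> v" by (rule absorb[OF v]) (simp add: eq)
  finally show ?thesis .
qed

lemma eqv_complete:
  assumes u: "u \<in> free_semigroup (alphabet n)" and v: "v \<in> free_semigroup (alphabet n)"
    and eq: "\<phi> n u = \<phi> n v"
  shows "u \<approx> v"
proof -
  have split: "\<exists>t e. tword t \<and> eword e \<and> w \<approx> t @ e \<and> t @ e \<in> free_semigroup (alphabet n) \<and> \<phi> n w = \<phi> n (t @ e)"
    if w: "w \<in> free_semigroup (alphabet n)" for w
  proof -
    obtain t e where te: "tword t" "eword e" "w \<approx> t @ e"
      using word_split[of w] w by (auto simp: free_semigroup_def)
    moreover have "t @ e \<in> lists (alphabet n)" using te tword_lists eword_lists by auto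
    ultimately have "t @ e \<in> free_semigroup (alphabet n) \<and> \<phi> n w = \<phi> n (t @ e)"
      using eqv_sound[OF te(3)] w by (auto simp: free_semigroup_def)
    then show ?thesis using te by blast
  qed
  obtain t e where te: "tword t" "eword e" "u \<approx> t @ e"
    "t @ e \<in> free_semigroup (alphabet n)" "\<phi> n u = \<phi> n (t @ e)" using split[OF u] by blast
  obtain t' e' where te': "tword t'" "eword e'" "v \<approx> t' @ e'"
    "t' @ e' \<in> free_semigroup (alphabet n)" "\<phi> n v = \<phi> n (t' @ e')" using split[OF v] by blast
  have "\<phi> n (t @ e) = \<phi> n (t' @ e')" using eq te(5) te'(5) by simp
  then have "equiv_cl n (word_pairs (t @ e)) = equiv_cl n (word_pairs (t' @ e'))"
    "\<And>x. x \<in> {1..n} \<Longrightarrow> (word_map (t @ e) x, word_map (t' @ e') x) \<in> equiv_cl n (word_pairs (t @ e))"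
    using phi_eq_iff[OF te(4) te'(4)] by blast+
  moreover have "word_pairs (t @ e) = word_pairs e" "word_pairs (t' @ e') = word_pairs e'" "word_map (t @ e) = word_map t" "word_map (t' @ e') = word_map t'"
    using te te' by (simp_all add: word_pairs_tword word_map_eword)
  ultimately have cl: "equiv_cl n (word_pairs e) = equiv_cl n (word_pairs e')"
    and maps: "\<And>x. x \<in> {1..n} \<Longrightarrow> (word_map t x, word_map t' x) \<in> equiv_cl n (word_pairs e)"
    by (simp_all del: fold_append word_pairs_append)
  have ee: "e \<approx> e'" using te(2) te'(2) cl by (rule eword_complete)
  have "t @ e \<approx> t' @ e"
  proof (cases "e = []")
    case True
    \<comment> \<open>By soundness the empty word is equivalent only to itself.\<close>
    then have "e' = []" using eqv_sound[OF ee] by auto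
    then have "t \<noteq> []" using te(4) True by (auto simp: free_semigroup_def)
    moreover have "equiv_cl n (word_pairs e) = Id_on {1..n}" using True by (intro equiv_cl_Id) auto
    ultimately have "word_map t x = word_map t' x" if "x \<in> {1..n}" for x
      using maps[OF that] by auto
    then have "t \<approx> t'" using \<open>t \<noteq> []\<close> te(1) te'(1) by (intro tword_complete)
    then show ?thesis by (rule eqv_right)
  next
    case False
    \<comment> \<open>\<open>?r\<close> sends each point to the least element of its class. The maps
      of \<open>t\<close> and \<open>t'\<close>, which agree modulo the equivalence, become equal
      after \<open>?r\<close>, while \<open>e\<close> absorbs \<open>?r\<close>.\<close>
    let ?r = "rep_word (\<lambda>x. equiv_cl n (word_pairs e) `` {x})"
    have equiv: "equiv {1..n} (equiv_cl n (word_pairs e))"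
      using te(2) word_pairs_sub eword_lists by (intro equiv_equiv_cl) auto
    have cl_iff: "equiv_cl n (word_pairs e) `` {x} = equiv_cl n (word_pairs e) `` {y} \<longleftrightarrow> (x, y) \<in> equiv_cl n (word_pairs e)"
      if "x \<in> {1..n}" "y \<in> {1..n}" for x y
      using eq_equiv_class_iff[OF equiv that] .
    obtain i j where ij: "E i j \<in> set e" "i \<in> {1..n}" "j \<in> {1..n}" "i \<noteq> j"
      using False te(2) by (cases e) auto
    then have "(i, j) \<in> equiv_cl n (word_pairs e)" using word_pairs_eword[OF te(2)] by (intro equiv_cl_base) blast
    then obtain k where "k \<in> {1..n}" "rep (\<lambda>x. equiv_cl n (word_pairs e) `` {x}) k \<noteq> k"
      using rep_moves[OF ij(2-4), of "\<lambda>x. equiv_cl n (word_pairs e) `` {x}"] cl_iff[OF ij(2,3)] by blast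
    then have "hole ?r k" by (rule hole_rep_word)
    \<comment> \<open>The empty word leaves no position empty. So \<open>t @ ?r\<close> is
      non-empty, as \<open>tword_complete\<close> demands.\<close>
    then have "?r \<noteq> []" by (auto simp: hole_def img_def)
    then have "t @ ?r \<approx> t' @ ?r"
      using maps te(1) te'(1) word_map_in tword_rep_word
      by (intro tword_complete) (auto simp: word_map_rep_word rep_eq_iff cl_iff)
    have r: "?r @ e \<approx> e"
    proof (rule rep_word_absorb)
      fix x assume x: "x \<in> {1..n}" "rep (\<lambda>x. equiv_cl n (word_pairs e) `` {x}) x \<noteq> x"
      then show "T (rep (\<lambda>x. equiv_cl n (word_pairs e) `` {x}) x) x # e \<approx> e"
        using rep_in[of x "\<lambda>x. equiv_cl n (word_pairs e) `` {x}"] te(2)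
        by (intro T_absorb_eword) (auto simp: cl_iff)
    qed
    have "t @ e \<approx> (t @ ?r) @ e" using eqv_left[OF eqv_sym[OF r], of t] by simp
    also have "\<dots> \<approx> (t' @ ?r) @ e" using \<open>t @ ?r \<approx> t' @ ?r\<close> by (rule eqv_right)
    also have "\<dots> \<approx> t' @ e" using eqv_left[OF r, of t'] by simp
    finally show ?thesis .
  qed
  also have "\<dots> \<approx> t' @ e'" using ee by (rule eqv_left)
  finally show ?thesis using te(3) te'(3) eqv_sym eqv_trans by blast
qed

subsection \<open>Surjectivity\<close>

text \<open>The first letter already prevents a permutation: \<open>T i j\<close> identifies two
  points, and \<open>E i j\<close> joins the images of \<open>i\<close> and \<open>j\<close> under
  the remaining word, which forces them to coincide if the equivalence is trivial.\<close>

lemma phi_sing: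
  assumes w: "w \<in> free_semigroup (alphabet n)"
  shows "\<phi> n w \<in> sing_full_domain n"
proof -
  have l: "w \<in> lists (alphabet n)" using w by (simp add: free_semigroup_def)
  have e: "equiv {1..n} (equiv_cl n (word_pairs w))" and maps: "\<And>x. x \<in> {1..n} \<Longrightarrow> word_map w x \<in> {1..n}"
    using l by (auto simp: equiv_equiv_cl word_pairs_sub word_map_in')
  have "\<not> (equiv_cl n (word_pairs w) = Id_on {1..n} \<and> inj_on (word_map w) {1..n})"
  proof
    assume *: "equiv_cl n (word_pairs w) = Id_on {1..n} \<and> inj_on (word_map w) {1..n}"
    obtain a v where w_eq: "w = a # v" using w by (cases w) (auto simp: free_semigroup_def)
    then have "a \<in> alphabet n" using l by simp
    then obtain i j where ij: "i \<in> {1..n}" "j \<in> {1..n}" "i \<noteq> j" and a: "a = E i j \<or> a = T i j"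
      unfolding alphabet_eq by blast
    have "word_map w i = word_map w j"
      using a
    proof
      assume a: "a = E i j"
      then have "(word_map v i, word_map v j) \<in> word_pairs w" using w_eq by auto
      then have "(word_map v i, word_map v j) \<in> Id_on {1..n}" using equiv_cl_base[of _ _ "word_pairs w" n] * by simp
      then show ?thesis using a w_eq by auto
    qed (use w_eq in simp)
    then show False using * ij by (auto dest: inj_onD)
  qed
  then show ?thesis unfolding phi_fd_partition[OF w] sing_full_domain_def
    using fd_partition_full_domain[where f = "word_map w", OF e maps] fd_partition_sym_iff[where f = "word_map w", OF e maps] by blast
qed

text \<open>A word with the kernel of \<open>f\<close> and an empty position is extended step by
  step; each step puts one misplaced token in its place and leaves the correct ones alone.\<close>

lemma tword_reach:
  assumes "\<And>x. x \<in> {1..n} \<Longrightarrow> f x \<in> {1..n}"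
    and "hole p k" "\<And>x y. x \<in> {1..n} \<Longrightarrow> y \<in> {1..n} \<Longrightarrow> word_map p x = word_map p y \<longleftrightarrow> f x = f y"
  shows "\<exists>w. tword w \<and> w \<noteq> [] \<and> (\<forall>x\<in>{1..n}. word_map w x = f x)"
  using assms(2,3)
proof (induction "card {x \<in> {1..n}. word_map p x \<noteq> f x}" arbitrary: p k rule: less_induct)
  case less
  show ?case
  proof (cases "\<exists>x\<in>{1..n}. word_map p x \<noteq> f x")
    case False
    moreover have "p \<noteq> []" using less.prems(1) by (auto simp: hole_def img_def)
    ultimately show ?thesis using holeD(1)[OF less.prems(1)] by blast
  next
    case True
    then obtain x where x: "x \<in> {1..n}" "word_map p x \<noteq> f x" by blast
    let ?z = "word_map p x" and ?y = "f x"
    have yz: "?y \<in> {1..n}" "?z \<in> {1..n}" "?z \<in> img p"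
      using x(1) assms(1) word_map_in[OF holeD(1)[OF less.prems(1)]] by (auto simp: img_def)
    have k: "k \<in> {1..n}" "k \<notin> img p" "tword p" using less.prems(1) by (auto simp: hole_def)
    \<comment> \<open>If the target is occupied, the tokens are swapped by means of
      \<open>k\<close>. If it is empty, a single slide suffices and \<open>?z\<close> becomes the
      empty position.\<close>
    obtain q k' where q: "hole (p @ q) k'"
      "\<And>v. v \<in> img p \<Longrightarrow> word_map q v = Transposition.transpose ?z ?y v"
    proof (cases "?y \<in> img p")
      case True
      then have d: "distinct [?z, ?y, k]" using k x yz by auto
      show thesis
      proof (rule that)
        show "hole (p @ swap_word k ?z ?y) k" by (rule hole_swap_word[OF less.prems(1) _ d]) (use yz in simp)
        show "word_map (swap_word k ?z ?y) v = Transposition.transpose ?z ?y v" if "v \<in> img p" for v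
          by (rule word_map_swap_word[OF d]) (use that k in auto)
      qed
    next
      case False
      then have "hole p ?y" using k yz by (simp add: hole_def)
      from hole_slide[OF this yz(2)] x have h: "hole (p @ [T ?y ?z]) ?z" by simp
      show thesis
        by (rule that[OF h]) (use False in \<open>auto simp: transpose_def\<close>)
    qed
    have Fpq: "word_map (p @ q) u = Transposition.transpose ?z ?y (word_map p u)" if "u \<in> {1..n}" for u
      using q(2)[of "word_map p u"] that by (auto simp: img_def)
    have sub: "{u \<in> {1..n}. word_map (p @ q) u \<noteq> f u} \<subset> {u \<in> {1..n}. word_map p u \<noteq> f u}"
    proof (rule psubsetI)
      show "{u \<in> {1..n}. word_map (p @ q) u \<noteq> f u} \<subseteq> {u \<in> {1..n}. word_map p u \<noteq> f u}"
      proof clarify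
        fix u assume u: "u \<in> {1..n}" "word_map (p @ q) u \<noteq> f u" "word_map p u = f u"
        \<comment> \<open>Equality of kernels shows that a correctly placed token sits neither at
          \<open>?z\<close> nor at \<open>?y\<close>, so the transposition fixes it.\<close>
        have "word_map p u = ?z \<longleftrightarrow> f u = ?y" using less.prems(2)[OF u(1) x(1)] .
        then have "word_map p u \<noteq> ?z" "word_map p u \<noteq> ?y" using u x by auto
        then show False using u Fpq[OF u(1)] by simp
      qed
      have "word_map (p @ q) x = f x" using Fpq[OF x(1)] by simp
      then show "{u \<in> {1..n}. word_map (p @ q) u \<noteq> f u} \<noteq> {u \<in> {1..n}. word_map p u \<noteq> f u}"
        using x by blast
    qed
    show ?thesis
    proof (rule less.hyps[OF psubset_card_mono[OF _ sub] q(1)])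
      show "word_map (p @ q) u = word_map (p @ q) v \<longleftrightarrow> f u = f v" if "u \<in> {1..n}" "v \<in> {1..n}" for u v
        unfolding Fpq[OF that(1)] Fpq[OF that(2)] transpose_eq_iff less.prems(2)[OF that] ..
    qed simp
  qed
qed

lemma singular_tword:
  assumes f: "\<And>x. x \<in> {1..n} \<Longrightarrow> f x \<in> {1..n}" and "\<not> inj_on f {1..n}"
  shows "\<exists>w. tword w \<and> w \<noteq> [] \<and> (\<forall>x\<in>{1..n}. word_map w x = f x)"
proof -
  obtain i j where "i \<in> {1..n}" "j \<in> {1..n}" "i \<noteq> j" "f i = f j"
    using assms(2) by (auto simp: inj_on_def)
  then obtain k where "hole (rep_word f) k" using rep_moves[of i j f] hole_rep_word by blast
  then show ?thesis
  proof (rule tword_reach[of f, rotated])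
    show "f x \<in> {1..n}" if "x \<in> {1..n}" for x using that by (rule f)
    fix x y assume xy: "x \<in> {1..n}" "y \<in> {1..n}"
    show "word_map (rep_word f) x = word_map (rep_word f) y \<longleftrightarrow> f x = f y"
      unfolding word_map_rep_word[OF xy(1)] word_map_rep_word[OF xy(2)] by (rule rep_eq_iff[OF xy])
  qed
qed

lemma equiv_eword:
  assumes e: "equiv {1..n} e"
  shows "\<exists>w. eword w \<and> equiv_cl n (word_pairs w) = e"
proof -
  have e_sub: "e \<subseteq> {1..n} \<times> {1..n}" using e by (simp add: equiv_def)
  then have "finite (e - Id)" using finite_subset by blast
  then obtain xs where xs: "set xs = e - Id" using finite_list by blast
  let ?w = "map (\<lambda>(x, y). E x y) xs"
  have w: "eword ?w" using xs e_sub by (auto simp: eword_def)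
  have mem: "(x, y) \<in> word_pairs ?w \<longleftrightarrow> (\<exists>(i, j)\<in>e - Id. {x, y} \<subseteq> {i, j})" for x y
    unfolding word_pairs_eword[OF w] xs[symmetric] by force
  have "word_pairs ?w \<subseteq> e"
  proof (rule subrelI)
    fix x y assume "(x, y) \<in> word_pairs ?w"
    then obtain i j where "(i, j) \<in> e" "{x, y} \<subseteq> {i, j}" using mem by blast
    then show "(x, y) \<in> e" using e e_sub unfolding equiv_def
      by (auto dest: symD refl_onD)
  qed
  then have "equiv_cl n (word_pairs ?w) \<subseteq> e" by (rule equiv_cl_least[OF e])
  moreover have "(x, y) \<in> equiv_cl n (word_pairs ?w)" if "(x, y) \<in> e" for x y
  proof (cases "x = y")
    case True
    then show ?thesis using that e_sub by (auto intro: equiv_cl_refl)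
  next
    case False
    then show ?thesis using that mem[of x y] by (intro equiv_cl_base) auto
  qed
  ultimately show ?thesis using w by (intro exI[of _ ?w]) auto
qed

lemma sing_phi:
  assumes "a \<in> sing_full_domain n"
  shows "a \<in> \<phi> n ` free_semigroup (alphabet n)"
proof -
  obtain f e where e: "equiv {1..n} e" and f: "\<And>x. x \<in> {1..n} \<Longrightarrow> f x \<in> {1..n}"
    and a: "a = fd_partition n f e"
    using assms full_domain_fd_partition unfolding sing_full_domain_def by blast
  have e_sub: "e \<subseteq> {1..n} \<times> {1..n}" using e by (simp add: equiv_def)
  obtain v where v: "eword v" "equiv_cl n (word_pairs v) = e" using equiv_eword[OF e] by blast
  \<comment> \<open>Only the class of \<open>f x\<close> matters, so \<open>f\<close> may be
    replaced by a singular map. If \<open>e\<close> is trivial, \<open>f\<close> itself is singular;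
    otherwise, composing with class representatives misses some \<open>k\<close>.\<close>
  have "\<exists>g. (\<forall>x\<in>{1..n}. g x \<in> {1..n}) \<and> \<not> inj_on g {1..n} \<and> (\<forall>x\<in>{1..n}. (g x, f x) \<in> e)"
  proof (cases "e = Id_on {1..n}")
    case True
    then have "\<not> inj_on f {1..n}"
      using fd_partition_sym_iff[where f = f, OF e f] assms a by (auto simp: sing_full_domain_def)
    then show ?thesis using f e by (intro exI[of _ f]) (auto simp: equiv_def refl_on_def)
  next
    case False
    let ?c = "\<lambda>x. e `` {x}"
    have c_iff: "?c x = ?c y \<longleftrightarrow> (x, y) \<in> e" if "x \<in> {1..n}" "y \<in> {1..n}" for x y
      using eq_equiv_class_iff[OF e that] .
    have "Id_on {1..n} \<subseteq> e" using e by (auto simp: equiv_def refl_on_def)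
    then obtain i j where ij: "(i, j) \<in> e" "i \<noteq> j" using False e_sub by blast
    then have "i \<in> {1..n}" "j \<in> {1..n}" using e_sub by auto
    then obtain k where k: "k \<in> {1..n}" "rep ?c k \<noteq> k"
      using rep_moves[of i j ?c] ij c_iff by auto
    let ?g = "\<lambda>x. rep ?c (f x)"
    have g: "?g x \<in> {1..n}" "?g x \<noteq> k" "(?g x, f x) \<in> e" if "x \<in> {1..n}" for x
      using rep_in[OF f[OF that], of ?c] rep_rep[OF f[OF that], of ?c] k c_iff[of "?g x" "f x"] f[OF that]
      by auto
    have "\<not> inj_on ?g {1..n}"
    proof
      assume "inj_on ?g {1..n}"
      moreover have "?g ` {1..n} \<subseteq> {1..n}" using g(1) by (rule image_subsetI)
      ultimately have surj: "?g ` {1..n} = {1..n}" by (intro endo_inj_surj) simp_all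
      have "k \<in> ?g ` {1..n}" unfolding surj by (rule k(1))
      then show False
      proof (rule imageE)
        fix x assume "k = ?g x" "x \<in> {1..n}"
        with g(2)[of x] show False by blast
      qed
    qed
    then show ?thesis using g by (intro exI[of _ ?g]) blast
  qed
  then obtain g where g: "\<And>x. x \<in> {1..n} \<Longrightarrow> g x \<in> {1..n}" "\<not> inj_on g {1..n}"
    "\<And>x. x \<in> {1..n} \<Longrightarrow> (g x, f x) \<in> e" by blast
  obtain u where u: "tword u" "u \<noteq> []" "\<And>x. x \<in> {1..n} \<Longrightarrow> word_map u x = g x"
    using singular_tword[OF g(1,2)] by blast
  have uv: "u @ v \<in> free_semigroup (alphabet n)"
    using u v tword_lists eword_lists by (auto simp: free_semigroup_def)
  have "\<phi> n (u @ v) = fd_partition n (word_map u) e"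
    using phi_fd_partition[OF uv] word_pairs_tword[OF u(1)] word_map_eword[OF v(1)] v(2) by (simp add: comp_def)
  also have "\<dots> = a"
    unfolding a using u g f e by (subst fd_partition_eq_iff) auto
  finally show ?thesis using uv by blast
qed

lemma phi_image: "\<phi> n ` free_semigroup (alphabet n) = sing_full_domain n"
  using phi_sing sing_phi by blast

section \<open>The presentation and idempotent generation\<close>

lemma phi_presentation:
  "has_semigroup_presentation (sing_full_domain n) (pmult n) (alphabet n) (relations n) (\<phi> n)"
proof -
  let ?X = "free_semigroup (alphabet n)"
  have app: "u @ v \<in> ?X" if "u \<in> ?X" "v \<in> ?X" for u v
    using that by (auto simp: free_semigroup_def)
  have "semigroup_on (sing_full_domain n) (pmult n)"
    \<comment> \<open>Closure and associativity are inherited from concatenation of words, since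
      \<open>\<phi> n\<close> is multiplicative and onto.\<close>
    unfolding semigroup_on_def phi_image[symmetric]
    by (auto simp: phi_append[symmetric] app)
  moreover have "{(u, v). u \<in> ?X \<and> v \<in> ?X \<and> \<phi> n u = \<phi> n v} = generated_congruence ?X (@) (relations n)"
    (is "?K = _")
  proof
    have "relations n \<subseteq> ?K" using relations_sound relations_free[of n] by blast
    then show "generated_congruence ?X (@) (relations n) \<subseteq> ?K"
      using kernel_congruence unfolding generated_congruence_def by blast
    show "?K \<subseteq> generated_congruence ?X (@) (relations n)"
      unfolding generated_congruence_def
    proof clarify
      fix u v C assume uv: "u \<in> ?X" "v \<in> ?X" "\<phi> n u = \<phi> n v"
        and C: "congruence_on ?X (@) C" "relations n \<subseteq> C"
      have "(u, u) \<in> C" using C(1) uv(1) by (auto simp: congruence_on_def equiv_def refl_on_def)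
      then show "(u, v) \<in> C"
        using eqv_congruence[OF C eqv_complete[OF uv]] uv(1) by (auto simp: free_semigroup_def)
    qed
  qed
  ultimately show ?thesis
    unfolding has_semigroup_presentation_def using relations_free phi_append phi_image by blast
qed

lemma letter_idempotent:
  assumes "a \<in> alphabet n"
  shows "pmult n (\<phi> n [a]) (\<phi> n [a]) = \<phi> n [a]"
proof -
  have "([a, a], [a]) \<in> relations n"
    using assms unfolding alphabet_eq by (auto intro: tt1 ee1)
  then have "\<phi> n ([a] @ [a]) = \<phi> n [a]" using relations_sound by simp
  then show ?thesis using assms by (subst phi_append[symmetric]) (auto simp: free_semigroup_def)
qed

lemma sing_idempotent_generated: "idempotent_generated (sing_full_domain n) (pmult n)"
proof -
  let ?X = "free_semigroup (alphabet n)" and ?S = "sing_full_domain n"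
  let ?G = "generated_subsemigroup (pmult n) {a \<in> ?S. pmult n a a = a}"
  have "\<phi> n w \<in> ?G" if "w \<noteq> []" "w \<in> lists (alphabet n)" for w
    using that
  \<comment> \<open>Images of words are products of images of letters, and the latter are idempotent
    by \<open>tt1\<close> and \<open>ee1\<close>.\<close>
  proof (induction w rule: list_nonempty_induct)
    case (single a)
    then have "\<phi> n [a] \<in> ?S" by (intro phi_sing) (simp add: free_semigroup_def)
    then show ?case using single letter_idempotent by (intro generated_subsemigroup.intros(1)) simp
  next
    case (cons a w)
    then have "\<phi> n [a] \<in> ?S" by (intro phi_sing) (simp add: free_semigroup_def)
    then have "\<phi> n [a] \<in> ?G" using cons letter_idempotent by (intro generated_subsemigroup.intros(1)) simp
    moreover have "\<phi> n ([a] @ w) = pmult n (\<phi> n [a]) (\<phi> n w)"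
      using cons by (intro phi_append) (auto simp: free_semigroup_def)
    ultimately show ?case using cons generated_subsemigroup.intros(2) by fastforce
  qed
  then have "?S \<subseteq> ?G" unfolding phi_image[symmetric] by (auto simp: free_semigroup_def)
  moreover have closed: "pmult n a b \<in> ?S" if "a \<in> ?S" "b \<in> ?S" for a b
    using phi_presentation that by (simp add: has_semigroup_presentation_def semigroup_on_def)
  have "a \<in> ?S" if "a \<in> ?G" for a
    using that by induction (simp_all add: closed)
  ultimately show ?thesis unfolding idempotent_generated_def by blast
qed

end

theorem theorem3p16:
  fixes n :: nat
  assumes "n \<ge> 2"
  shows "has_semigroup_presentation (sing_full_domain n) (pmult n) (alphabet n) (relations n) (\<phi> n)
    \<and> idempotent_generated (sing_full_domain n) (pmult n)"
  using fixed_degree.phi_presentation fixed_degree.sing_idempotent_generated by blast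

end
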